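(* The 2-category $\mathcal{C}$ of small categories admits pseudo colimits: every pseudo functor $F:\mathcal{J}\to\mathcal{C}$ from a small 1-category $\mathcal{J}$ admits a pseudo colimit in $\mathcal{C}$.
   Context: $\mathcal{C}$ has small categories as objects, functors as morphisms and natural transformations as 2-cells. Pseudo functors and pseudo natural transformations have invertible coherence 2-cells. For a pseudo functor $F:\mathcal{J}\to\mathcal{C}$, a pseudo colimit is an object $W$ of $\mathcal{C}$ with a pseudo natural transformation $\pi:F\Rightarrow\Delta_W$ to the constant 2-functor such that for every object $V$ the functor $(\circ\,\pi):Mor_{\mathcal{C}}(W,V)\to PseudoCone(F,V)$ is an isomorphism of categories (not merely an equivalence), where $PseudoCone(F,V)$ has as objects the pseudo natural transformations $F\Rightarrow\Delta_V$ and as morphisms the modifications. *)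

theory Defs
  imports "HOL-Library.FuncSet"
begin

unbundle cardinal_syntax

section \<open>Categories, functors and natural transformations\<close>

record ('o, 'm) cat =
  Obj :: "'o set"
  Mor :: "'m set"
  Dom :: "'m \<Rightarrow> 'o"
  Cod :: "'m \<Rightarrow> 'o"
  Ident :: "'o \<Rightarrow> 'm"
  Comp :: "'m \<Rightarrow> 'm \<Rightarrow> 'm"  \<comment> \<open>\<open>Comp C g f\<close> is g after f\<close>

definition hom :: "('o, 'm) cat \<Rightarrow> 'o \<Rightarrow> 'o \<Rightarrow> 'm set" where
  "hom C a b = {f \<in> Mor C. Dom C f = a \<and> Cod C f = b}"

locale category =
  fixes C :: "('o, 'm) cat"
  assumes Dom_Obj: "f \<in> Mor C \<Longrightarrow> Dom C f \<in> Obj C"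
    and Cod_Obj: "f \<in> Mor C \<Longrightarrow> Cod C f \<in> Obj C"
    and Ident_hom: "a \<in> Obj C \<Longrightarrow> Ident C a \<in> hom C a a"
    and Comp_hom: "f \<in> hom C a b \<Longrightarrow> g \<in> hom C b c \<Longrightarrow> Comp C g f \<in> hom C a c"
    and Comp_Ident: "f \<in> hom C a b \<Longrightarrow> Comp C f (Ident C a) = f"
    and Ident_Comp: "f \<in> hom C a b \<Longrightarrow> Comp C (Ident C b) f = f"
    and Comp_assoc: "f \<in> hom C a b \<Longrightarrow> g \<in> hom C b c \<Longrightarrow> h \<in> hom C c d
      \<Longrightarrow> Comp C h (Comp C g f) = Comp C (Comp C h g) f"

text \<open>
  Functors, families of components and so on are extensional, i.e. \<open>undefined\<close> off their
  carrier, so that HOL equality of the encodings is equality of the encoded objects.  This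
  matters because a pseudo colimit is characterised by an isomorphism of categories.
\<close>

record ('o, 'm, 'p, 'n) ftr =
  fobj :: "'o \<Rightarrow> 'p"
  fmor :: "'m \<Rightarrow> 'n"

locale cat_functor = A: category A + B: category B
  for A :: "('o, 'm) cat" and B :: "('p, 'n) cat" +
  fixes F :: "('o, 'm, 'p, 'n) ftr"
  assumes fobj: "fobj F \<in> Obj A \<rightarrow>\<^sub>E Obj B"
    and fmor_ext: "fmor F \<in> extensional (Mor A)"
    and fmor_hom: "f \<in> hom A a b \<Longrightarrow> fmor F f \<in> hom B (fobj F a) (fobj F b)"
    and fmor_Ident: "a \<in> Obj A \<Longrightarrow> fmor F (Ident A a) = Ident B (fobj F a)"
    and fmor_Comp: "f \<in> hom A a b \<Longrightarrow> g \<in> hom A b c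
      \<Longrightarrow> fmor F (Comp A g f) = Comp B (fmor F g) (fmor F f)"

definition id_ftr :: "('o, 'm) cat \<Rightarrow> ('o, 'm, 'o, 'm) ftr" where
  "id_ftr A = \<lparr>fobj = restrict id (Obj A), fmor = restrict id (Mor A)\<rparr>"

text \<open>The first argument of the operations below is the source category of the result.\<close>

definition comp_ftr ::
  "('o, 'm) cat \<Rightarrow> ('p, 'n, 'q, 'r) ftr \<Rightarrow> ('o, 'm, 'p, 'n) ftr \<Rightarrow> ('o, 'm, 'q, 'r) ftr" where
  "comp_ftr A G F =
    \<lparr>fobj = compose (Obj A) (fobj G) (fobj F), fmor = compose (Mor A) (fmor G) (fmor F)\<rparr>"

definition iso_of_categories ::
  "('o, 'm) cat \<Rightarrow> ('p, 'n) cat \<Rightarrow> ('o, 'm, 'p, 'n) ftr \<Rightarrow> bool" where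
  "iso_of_categories A B F \<longleftrightarrow> cat_functor A B F \<and>
    (\<exists>G. cat_functor B A G \<and> comp_ftr A G F = id_ftr A \<and> comp_ftr B F G = id_ftr B)"

locale nat_trans = F: cat_functor A B F + G: cat_functor A B G
  for A :: "('o, 'm) cat" and B :: "('p, 'n) cat" and F G :: "('o, 'm, 'p, 'n) ftr" +
  fixes \<alpha> :: "'o \<Rightarrow> 'n"
  assumes ext: "\<alpha> \<in> extensional (Obj A)"
    and component: "a \<in> Obj A \<Longrightarrow> \<alpha> a \<in> hom B (fobj F a) (fobj G a)"
    and natural: "f \<in> hom A a b \<Longrightarrow> Comp B (fmor G f) (\<alpha> a) = Comp B (\<alpha> b) (fmor F f)"

definition id_nt ::
  "('o, 'm) cat \<Rightarrow> ('p, 'n) cat \<Rightarrow> ('o, 'm, 'p, 'n) ftr \<Rightarrow> 'o \<Rightarrow> 'n" where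
  "id_nt A B F = (\<lambda>a\<in>Obj A. Ident B (fobj F a))"

definition vcomp ::
  "('o, 'm) cat \<Rightarrow> ('p, 'n) cat \<Rightarrow> ('o \<Rightarrow> 'n) \<Rightarrow> ('o \<Rightarrow> 'n) \<Rightarrow> 'o \<Rightarrow> 'n" where
  "vcomp A B \<beta> \<alpha> = (\<lambda>a\<in>Obj A. Comp B (\<beta> a) (\<alpha> a))"

text \<open>The whiskerings \<open>G * \<alpha>\<close> (post-composition with \<open>G\<close>) and \<open>\<alpha> * F\<close> (pre-composition with \<open>F\<close>).\<close>

definition post_whisker ::
  "('o, 'm) cat \<Rightarrow> ('p, 'n, 'q, 'r) ftr \<Rightarrow> ('o \<Rightarrow> 'n) \<Rightarrow> 'o \<Rightarrow> 'r" where
  "post_whisker A G \<alpha> = (\<lambda>a\<in>Obj A. fmor G (\<alpha> a))"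

definition pre_whisker ::
  "('o, 'm) cat \<Rightarrow> ('p \<Rightarrow> 'r) \<Rightarrow> ('o, 'm, 'p, 'n) ftr \<Rightarrow> 'o \<Rightarrow> 'r" where
  "pre_whisker A \<alpha> F = (\<lambda>a\<in>Obj A. \<alpha> (fobj F a))"

definition invertible_nt ::
  "('o, 'm) cat \<Rightarrow> ('p, 'n) cat \<Rightarrow> ('o, 'm, 'p, 'n) ftr \<Rightarrow> ('o, 'm, 'p, 'n) ftr
    \<Rightarrow> ('o \<Rightarrow> 'n) \<Rightarrow> bool" where
  "invertible_nt A B F G \<alpha> \<longleftrightarrow> nat_trans A B F G \<alpha> \<and>
    (\<exists>\<beta>. nat_trans A B G F \<beta> \<and> vcomp A B \<beta> \<alpha> = id_nt A B F \<and> vcomp A B \<alpha> \<beta> = id_nt A B G)"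

text \<open>
  The hom-category of functors from \<open>A\<close> to \<open>B\<close>.  A morphism carries its source and target
  functors, since a family of components does not determine them.
\<close>

definition fun_cat :: "('o, 'm) cat \<Rightarrow> ('p, 'n) cat \<Rightarrow>
    (('o, 'm, 'p, 'n) ftr,
     ('o, 'm, 'p, 'n) ftr \<times> ('o \<Rightarrow> 'n) \<times> ('o, 'm, 'p, 'n) ftr) cat" where
  "fun_cat A B =
    \<lparr>Obj = {F. cat_functor A B F},
     Mor = {(F, \<alpha>, G). nat_trans A B F G \<alpha>},
     Dom = (\<lambda>(F, \<alpha>, G). F),
     Cod = (\<lambda>(F, \<alpha>, G). G),
     Ident = (\<lambda>F. (F, id_nt A B F, F)),
     Comp = (\<lambda>(_, \<beta>, H) (F, \<alpha>, _). (F, vcomp A B \<beta> \<alpha>, H))\<rparr>"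


section \<open>Smallness\<close>

text \<open>
  HOL has no type of all sets, so smallness is relative to a universe, given by a
  regular uncountable cardinal \<open>\<kappa>\<close>: small means of cardinality less than \<open>\<kappa>\<close>.  For \<open>\<kappa>\<close> strongly
  inaccessible these are, up to bijection, the elements of a Grothendieck universe; the
  strong limit property is not assumed.  Since \<open>\<kappa>\<close> is a relation on \<open>'u\<close>, every small set is
  in bijection with a subset of \<open>'u\<close>, so the small categories of type \<open>('u, 'u) cat\<close>
  include every small category up to isomorphism.
\<close>

locale universe =
  fixes \<kappa> :: "'u rel"
  assumes card_order: "Card_order \<kappa>"
    and regular: "regularCard \<kappa>"
    and uncountable: "natLeq <o \<kappa>"

lemma universe_aleph1: "universe (cardSuc natLeq)"
  by unfold_locales
    (simp_all add: natLeq_Card_order natLeq_Cinfinite regularCard_cardSuc cardSuc_greater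
      cardSuc_Card_order)

definition small_category :: "'u rel \<Rightarrow> ('o, 'm) cat \<Rightarrow> bool" where
  "small_category \<kappa> C \<longleftrightarrow> category C \<and> |Obj C| <o \<kappa> \<and> |Mor C| <o \<kappa>"


section \<open>Pseudo functors, pseudo natural transformations and modifications\<close>

text \<open>
  Pseudo functors from a 1-category \<open>J\<close> to the 2-category of small categories.  The coherence
  2-cells are \<open>punit F i : id \<Rightarrow> F(id\<^sub>i)\<close> and \<open>pcomp F g f : F g \<circ> F f \<Rightarrow> F(g \<circ> f)\<close>.
  As \<open>J\<close> has only identity 2-cells, naturality of these in \<open>f\<close> and \<open>g\<close> is vacuous.
\<close>

record ('j, 'k, 'o, 'm) psfun =
  pobj :: "'j \<Rightarrow> ('o, 'm) cat"
  pmor :: "'k \<Rightarrow> ('o, 'm, 'o, 'm) ftr"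
  punit :: "'j \<Rightarrow> 'o \<Rightarrow> 'm"
  pcomp :: "'k \<Rightarrow> 'k \<Rightarrow> 'o \<Rightarrow> 'm"

locale pseudo_functor = J: category J
  for \<kappa> :: "'u rel" and J :: "('j, 'k) cat" +
  fixes F :: "('j, 'k, 'o, 'm) psfun"
  assumes pobj: "i \<in> Obj J \<Longrightarrow> small_category \<kappa> (pobj F i)"
    and pmor: "f \<in> hom J i j \<Longrightarrow> cat_functor (pobj F i) (pobj F j) (pmor F f)"
    and punit: "i \<in> Obj J \<Longrightarrow> invertible_nt (pobj F i) (pobj F i)
      (id_ftr (pobj F i)) (pmor F (Ident J i)) (punit F i)"
    and pcomp: "f \<in> hom J i j \<Longrightarrow> g \<in> hom J j k \<Longrightarrow> invertible_nt (pobj F i) (pobj F k)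
      (comp_ftr (pobj F i) (pmor F g) (pmor F f)) (pmor F (Comp J g f)) (pcomp F g f)"
    and left_unit: "f \<in> hom J i j \<Longrightarrow>
      vcomp (pobj F i) (pobj F j)
        (pcomp F (Ident J j) f) (pre_whisker (pobj F i) (punit F j) (pmor F f))
      = id_nt (pobj F i) (pobj F j) (pmor F f)"
    and right_unit: "f \<in> hom J i j \<Longrightarrow>
      vcomp (pobj F i) (pobj F j)
        (pcomp F f (Ident J i)) (post_whisker (pobj F i) (pmor F f) (punit F i))
      = id_nt (pobj F i) (pobj F j) (pmor F f)"
    and assoc: "f \<in> hom J i j \<Longrightarrow> g \<in> hom J j k \<Longrightarrow> h \<in> hom J k l \<Longrightarrow>
      vcomp (pobj F i) (pobj F l)
        (pcomp F h (Comp J g f)) (post_whisker (pobj F i) (pmor F h) (pcomp F g f))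
      = vcomp (pobj F i) (pobj F l)
        (pcomp F (Comp J h g) f) (pre_whisker (pobj F i) (pcomp F h g) (pmor F f))"

definition const_psfun :: "('o, 'm) cat \<Rightarrow> ('j, 'k, 'o, 'm) psfun" where
  "const_psfun V =
    \<lparr>pobj = (\<lambda>_. V),
     pmor = (\<lambda>_. id_ftr V),
     punit = (\<lambda>_. id_nt V V (id_ftr V)),
     pcomp = (\<lambda>_ _. id_nt V V (id_ftr V))\<rparr>"

text \<open>The coherence 2-cell of \<open>\<tau>\<close> at \<open>f : i \<rightarrow> j\<close> is \<open>tcell \<tau> f : G f \<circ> \<tau>\<^sub>i \<Rightarrow> \<tau>\<^sub>j \<circ> F f\<close>.\<close>

record ('j, 'k, 'o, 'm) psnat =
  tcomp :: "'j \<Rightarrow> ('o, 'm, 'o, 'm) ftr"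
  tcell :: "'k \<Rightarrow> 'o \<Rightarrow> 'm"

locale pseudo_nat = F: pseudo_functor \<kappa> J F + G: pseudo_functor \<kappa> J G
  for \<kappa> :: "'u rel" and J :: "('j, 'k) cat" and F G :: "('j, 'k, 'o, 'm) psfun" +
  fixes \<tau> :: "('j, 'k, 'o, 'm) psnat"
  assumes tcomp_ext: "tcomp \<tau> \<in> extensional (Obj J)"
    and tcell_ext: "tcell \<tau> \<in> extensional (Mor J)"
    and tcomp: "i \<in> Obj J \<Longrightarrow> cat_functor (pobj F i) (pobj G i) (tcomp \<tau> i)"
    and tcell: "f \<in> hom J i j \<Longrightarrow> invertible_nt (pobj F i) (pobj G j)
      (comp_ftr (pobj F i) (pmor G f) (tcomp \<tau> i))
      (comp_ftr (pobj F i) (tcomp \<tau> j) (pmor F f)) (tcell \<tau> f)"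
    and tcell_unit: "i \<in> Obj J \<Longrightarrow>
      vcomp (pobj F i) (pobj G i)
        (tcell \<tau> (Ident J i)) (pre_whisker (pobj F i) (punit G i) (tcomp \<tau> i))
      = post_whisker (pobj F i) (tcomp \<tau> i) (punit F i)"
    and tcell_comp: "f \<in> hom J i j \<Longrightarrow> g \<in> hom J j k \<Longrightarrow>
      vcomp (pobj F i) (pobj G k)
        (tcell \<tau> (Comp J g f)) (pre_whisker (pobj F i) (pcomp G g f) (tcomp \<tau> i))
      = vcomp (pobj F i) (pobj G k)
        (post_whisker (pobj F i) (tcomp \<tau> k) (pcomp F g f))
        (vcomp (pobj F i) (pobj G k)
          (pre_whisker (pobj F i) (tcell \<tau> g) (pmor F f))
          (post_whisker (pobj F i) (pmor G g) (tcell \<tau> f)))"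

locale modification = S: pseudo_nat \<kappa> J F G \<sigma> + T: pseudo_nat \<kappa> J F G \<tau>
  for \<kappa> :: "'u rel" and J :: "('j, 'k) cat" and F G :: "('j, 'k, 'o, 'm) psfun"
    and \<sigma> \<tau> :: "('j, 'k, 'o, 'm) psnat" +
  fixes \<Gamma> :: "'j \<Rightarrow> 'o \<Rightarrow> 'm"
  assumes mod_ext: "\<Gamma> \<in> extensional (Obj J)"
    and mod_component: "i \<in> Obj J \<Longrightarrow>
      nat_trans (pobj F i) (pobj G i) (tcomp \<sigma> i) (tcomp \<tau> i) (\<Gamma> i)"
    and mod_natural: "f \<in> hom J i j \<Longrightarrow>
      vcomp (pobj F i) (pobj G j)
        (tcell \<tau> f) (post_whisker (pobj F i) (pmor G f) (\<Gamma> i))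
      = vcomp (pobj F i) (pobj G j)
        (pre_whisker (pobj F i) (\<Gamma> j) (pmor F f)) (tcell \<sigma> f)"


section \<open>Pseudo colimits\<close>

definition pseudo_cone_cat :: "'u rel \<Rightarrow> ('j, 'k) cat \<Rightarrow> ('j, 'k, 'o, 'm) psfun \<Rightarrow> ('o, 'm) cat \<Rightarrow>
    (('j, 'k, 'o, 'm) psnat,
     ('j, 'k, 'o, 'm) psnat \<times> ('j \<Rightarrow> 'o \<Rightarrow> 'm) \<times> ('j, 'k, 'o, 'm) psnat) cat" where
  "pseudo_cone_cat \<kappa> J F V =
    \<lparr>Obj = {\<sigma>. pseudo_nat \<kappa> J F (const_psfun V) \<sigma>},
     Mor = {(\<sigma>, \<Gamma>, \<tau>). modification \<kappa> J F (const_psfun V) \<sigma> \<tau> \<Gamma>},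
     Dom = (\<lambda>(\<sigma>, \<Gamma>, \<tau>). \<sigma>),
     Cod = (\<lambda>(\<sigma>, \<Gamma>, \<tau>). \<tau>),
     Ident = (\<lambda>\<sigma>. (\<sigma>, \<lambda>i\<in>Obj J. id_nt (pobj F i) V (tcomp \<sigma> i), \<sigma>)),
     Comp = (\<lambda>(_, \<Delta>, \<rho>) (\<sigma>, \<Gamma>, _).
       (\<sigma>, \<lambda>i\<in>Obj J. vcomp (pobj F i) V (\<Delta> i) (\<Gamma> i), \<rho>))\<rparr>"

text \<open>
  For \<open>\<pi> : F \<Rightarrow> \<Delta>\<^sub>W\<close> and \<open>G : W \<rightarrow> V\<close>, the 2-cell of \<open>G \<circ> \<pi>\<close> at \<open>f : i \<rightarrow> j\<close> is
  \<open>G * \<pi>\<^sub>f : G \<circ> \<pi>\<^sub>i \<Rightarrow> G \<circ> \<pi>\<^sub>j \<circ> F f\<close>.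
\<close>

definition comp_cone :: "('j, 'k) cat \<Rightarrow> ('j, 'k, 'o, 'm) psfun \<Rightarrow>
    ('j, 'k, 'o, 'm) psnat \<Rightarrow> ('o, 'm, 'o, 'm) ftr \<Rightarrow> ('j, 'k, 'o, 'm) psnat" where
  "comp_cone J F \<pi> G =
    \<lparr>tcomp = (\<lambda>i\<in>Obj J. comp_ftr (pobj F i) G (tcomp \<pi> i)),
     tcell = (\<lambda>f\<in>Mor J. post_whisker (pobj F (Dom J f)) G (tcell \<pi> f))\<rparr>"

definition comp_cone_ftr :: "('j, 'k) cat \<Rightarrow> ('j, 'k, 'o, 'm) psfun \<Rightarrow>
    ('o, 'm) cat \<Rightarrow> ('j, 'k, 'o, 'm) psnat \<Rightarrow> ('o, 'm) cat \<Rightarrow>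
    (('o, 'm, 'o, 'm) ftr,
     ('o, 'm, 'o, 'm) ftr \<times> ('o \<Rightarrow> 'm) \<times> ('o, 'm, 'o, 'm) ftr,
     ('j, 'k, 'o, 'm) psnat,
     ('j, 'k, 'o, 'm) psnat \<times> ('j \<Rightarrow> 'o \<Rightarrow> 'm) \<times> ('j, 'k, 'o, 'm) psnat) ftr" where
  "comp_cone_ftr J F W \<pi> V =
    \<lparr>fobj = (\<lambda>G\<in>Obj (fun_cat W V). comp_cone J F \<pi> G),
     fmor = (\<lambda>(G, \<alpha>, H)\<in>Mor (fun_cat W V).
       (comp_cone J F \<pi> G,
        \<lambda>i\<in>Obj J. pre_whisker (pobj F i) \<alpha> (tcomp \<pi> i),
        comp_cone J F \<pi> H))\<rparr>"

definition is_pseudo_colimit :: "'u rel \<Rightarrow> ('j, 'k) cat \<Rightarrow> ('j, 'k, 'o, 'm) psfun \<Rightarrow>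
    ('o, 'm) cat \<Rightarrow> ('j, 'k, 'o, 'm) psnat \<Rightarrow> bool" where
  "is_pseudo_colimit \<kappa> J F W \<pi> \<longleftrightarrow>
    small_category \<kappa> W \<and> pseudo_nat \<kappa> J F (const_psfun W) \<pi> \<and>
    (\<forall>V. small_category \<kappa> V \<longrightarrow>
      iso_of_categories (fun_cat W V) (pseudo_cone_cat \<kappa> J F V) (comp_cone_ftr J F W \<pi> V))"

end

theory Submission
  imports Defs
begin

text \<open>
  The pseudo colimit \<open>W\<close> is presented by generators.  Its objects are the pairs of an index \<open>i\<close> and
  an object \<open>x\<close> of \<open>F i\<close>; its morphisms are generated by the morphisms of the \<open>F i\<close> and, for
  \<open>f : i \<rightarrow> j\<close> and \<open>x\<close> in \<open>F i\<close>, by a pair of mutually inverse arrows between \<open>(i, x)\<close> and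
  \<open>(j, F f x)\<close>.  Every pseudo cone interprets these generators, and two paths are identified when
  all pseudo cones with small vertex give them the same value; in other words the evaluations
  embed the hom-sets of \<open>W\<close> in products of hom-sets of the vertices.  Hence every equation
  that holds for all cones holds in \<open>W\<close>, which makes the generators a pseudo cone, and every
  cone factors by evaluation, uniquely since \<open>W\<close> is generated.  As \<open>\<kappa>\<close> is regular and
  uncountable there are fewer than \<open>\<kappa>\<close> paths, so \<open>W\<close> is small and can be relabelled to live in \<open>'u\<close>.
\<close>

section \<open>Categories of functors\<close>

text \<open>A congruence generated by the laws of a cone would call for an induction over
  derivations at every use. Here a class of paths is simply its tuple of values, so the projection
  to one coordinate is at once the functor through which the corresponding cone factors. The price
  is size: the tuples are indexed by all cones and inhabit a type far above \<open>'u\<close>. The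
  number of morphisms is still bounded by that of paths, so the structure can be moved along
  injections into \<open>'u\<close>; only then has \<open>W\<close> the type of the test vertices.
  The inverse arrows must be generators because the cells of a cone have to be invertible. They do
  not spoil uniqueness, since a functor sends them to inverses and inverses are unique. As the
  objects of \<open>W\<close> correspond exactly to the pairs, a functor out of \<open>W\<close> is
  fixed on the nose by its cone, and the comparison is an isomorphism rather than an equivalence.
  Uncountability of \<kappa> is felt already on finite data: two parallel arrows of
  \<open>J\<close>, sent to functors between terminal categories, give a \<open>W\<close> with an
  infinite cyclic automorphism group.\<close>

lemma hom_MorD: "f \<in> hom C a b \<Longrightarrow> f \<in> Mor C"
  by (simp add: hom_def)

lemma Mor_hom: "f \<in> Mor C \<Longrightarrow> f \<in> hom C (Dom C f) (Cod C f)"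
  by (simp add: hom_def)

context category
begin

lemma hom_Obj1: "f \<in> hom C a b \<Longrightarrow> a \<in> Obj C"
  using Dom_Obj by (auto simp: hom_def)

lemma hom_Obj2: "f \<in> hom C a b \<Longrightarrow> b \<in> Obj C"
  using Cod_Obj by (auto simp: hom_def)

end

context cat_functor
begin

lemma fobj_Obj: "a \<in> Obj A \<Longrightarrow> fobj F a \<in> Obj B"
  using fobj by auto

lemma fobj_extensional: "fobj F \<in> extensional (Obj A)"
  using fobj by (auto simp: PiE_def)

end

lemma cat_functorI:
  assumes "category A" "category B"
    and "fobj F \<in> extensional (Obj A)" "\<And>a. a \<in> Obj A \<Longrightarrow> fobj F a \<in> Obj B"
    and "fmor F \<in> extensional (Mor A)"
    and "\<And>a b f. f \<in> hom A a b \<Longrightarrow> fmor F f \<in> hom B (fobj F a) (fobj F b)"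
    and "\<And>a. a \<in> Obj A \<Longrightarrow> fmor F (Ident A a) = Ident B (fobj F a)"
    and "\<And>a b c f g. f \<in> hom A a b \<Longrightarrow> g \<in> hom A b c
      \<Longrightarrow> fmor F (Comp A g f) = Comp B (fmor F g) (fmor F f)"
  shows "cat_functor A B F"
  using assms by (simp add: cat_functor_def cat_functor_axioms_def PiE_def Pi_def)

lemma ftr_eqI:
  fixes F G :: "('o, 'm, 'p, 'n) ftr"
  assumes "fobj F \<in> extensional X" "fobj G \<in> extensional X"
    and "fmor F \<in> extensional Y" "fmor G \<in> extensional Y"
    and "\<And>a. a \<in> X \<Longrightarrow> fobj F a = fobj G a" "\<And>f. f \<in> Y \<Longrightarrow> fmor F f = fmor G f"
  shows "F = G"
proof -
  have "fobj F = fobj G" "fmor F = fmor G"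
    using assms by (blast intro: extensionalityI)+
  then show ?thesis by simp
qed

lemma cat_functor_eqI:
  assumes "cat_functor A B F" "cat_functor A B G"
    and "\<And>a. a \<in> Obj A \<Longrightarrow> fobj F a = fobj G a" "\<And>f. f \<in> Mor A \<Longrightarrow> fmor F f = fmor G f"
  shows "F = G"
  using assms cat_functor.fobj_extensional cat_functor.fmor_ext
  by (intro ftr_eqI[of F "Obj A" G "Mor A"]) blast+

lemma nat_transI:
  assumes "cat_functor A B F" "cat_functor A B G" "\<alpha> \<in> extensional (Obj A)"
    and "\<And>a. a \<in> Obj A \<Longrightarrow> \<alpha> a \<in> hom B (fobj F a) (fobj G a)"
    and "\<And>a b f. f \<in> hom A a b \<Longrightarrow> Comp B (fmor G f) (\<alpha> a) = Comp B (\<alpha> b) (fmor F f)"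
  shows "nat_trans A B F G \<alpha>"
  using assms by (simp add: nat_trans_def nat_trans_axioms_def)

lemma id_ftr_simps [simp]:
  "a \<in> Obj A \<Longrightarrow> fobj (id_ftr A) a = a"
  "f \<in> Mor A \<Longrightarrow> fmor (id_ftr A) f = f"
  by (simp_all add: id_ftr_def)

lemma comp_ftr_simps [simp]:
  "a \<in> Obj A \<Longrightarrow> fobj (comp_ftr A G F) a = fobj G (fobj F a)"
  "f \<in> Mor A \<Longrightarrow> fmor (comp_ftr A G F) f = fmor G (fmor F f)"
  by (simp_all add: comp_ftr_def compose_def)

lemma comp_ftr_extensional:
  "fobj (comp_ftr A G F) \<in> extensional (Obj A)"
  "fmor (comp_ftr A G F) \<in> extensional (Mor A)"
  by (simp_all add: comp_ftr_def)

lemma id_ftr_functor: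
  assumes "category A"
  shows "cat_functor A A (id_ftr A)"
proof -
  interpret category A by fact
  show ?thesis
  proof (rule cat_functorI)
    fix a b f assume f: "f \<in> hom A a b"
    then show "fmor (id_ftr A) f \<in> hom A (fobj (id_ftr A) a) (fobj (id_ftr A) b)"
      by (simp add: hom_MorD hom_Obj1[OF f] hom_Obj2[OF f])
  next
    fix a b c f g assume "f \<in> hom A a b" "g \<in> hom A b c"
    then show "fmor (id_ftr A) (Comp A g f) = Comp A (fmor (id_ftr A) g) (fmor (id_ftr A) f)"
      using hom_MorD[OF Comp_hom[of f a b g c]] by (simp add: hom_MorD)
  qed (auto simp: category_axioms id_ftr_def hom_MorD[OF Ident_hom])
qed

lemma comp_ftr_functor:
  assumes "cat_functor A B F" "cat_functor B C G"
  shows "cat_functor A C (comp_ftr A G F)"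
proof -
  interpret F: cat_functor A B F by fact
  interpret G: cat_functor B C G by fact
  show ?thesis
  proof (rule cat_functorI)
    fix a b c f g assume "f \<in> hom A a b" "g \<in> hom A b c"
    then show "fmor (comp_ftr A G F) (Comp A g f)
        = Comp C (fmor (comp_ftr A G F) g) (fmor (comp_ftr A G F) f)"
      using hom_MorD[OF F.A.Comp_hom[of f a b g c]]
      by (simp add: F.fmor_Comp G.fmor_Comp[OF F.fmor_hom F.fmor_hom] hom_MorD)
  next
    fix a b f assume f: "f \<in> hom A a b"
    then show "fmor (comp_ftr A G F) f
        \<in> hom C (fobj (comp_ftr A G F) a) (fobj (comp_ftr A G F) b)"
      using G.fmor_hom[OF F.fmor_hom[OF f]]
      by (simp add: hom_MorD F.A.hom_Obj1[OF f] F.A.hom_Obj2[OF f])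
  next
    fix a assume a: "a \<in> Obj A"
    then show "fmor (comp_ftr A G F) (Ident A a) = Ident C (fobj (comp_ftr A G F) a)"
      using hom_MorD[OF F.A.Ident_hom[OF a]]
      by (simp add: F.fmor_Ident G.fmor_Ident F.fobj_Obj)
  qed (auto simp: F.A.category_axioms G.B.category_axioms F.fobj_Obj G.fobj_Obj
      comp_ftr_extensional)
qed

lemma comp_ftr_id_left:
  assumes "cat_functor A B F" shows "comp_ftr A (id_ftr B) F = F"
proof -
  interpret cat_functor A B F by fact
  show ?thesis
    by (intro cat_functor_eqI[of A B] comp_ftr_functor[where B = B] id_ftr_functor
        B.category_axioms assms) (auto simp: fobj_Obj hom_MorD[OF fmor_hom[OF Mor_hom]])
qed

text \<open>The inverse maps on objects and on morphisms form a functor, because \<open>F\<close>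
  preserves identities and composition and is injective. The comparison functor of the colimit is
  treated through this criterion.\<close>

lemma iso_of_categoriesI:
  assumes F: "cat_functor A B F"
    and obj: "bij_betw (fobj F) (Obj A) (Obj B)" and mor: "bij_betw (fmor F) (Mor A) (Mor B)"
  shows "iso_of_categories A B F"
proof -
  interpret cat_functor A B F by fact
  define o' where "o' = inv_into (Obj A) (fobj F)"
  define m' where "m' = inv_into (Mor A) (fmor F)"
  have o'F [simp]: "a \<in> Obj A \<Longrightarrow> o' (fobj F a) = a" for a
    using obj by (simp add: o'_def bij_betw_def)
  have m'F [simp]: "f \<in> Mor A \<Longrightarrow> m' (fmor F f) = f" for f
    using mor by (simp add: m'_def bij_betw_def)
  have Fo': "fobj F (o' b) = b" "o' b \<in> Obj A" if "b \<in> Obj B" for b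
    using obj that unfolding o'_def bij_betw_def by (auto simp: f_inv_into_f inv_into_into)
  have Fm': "fmor F (m' g) = g" "m' g \<in> Mor A" if "g \<in> Mor B" for g
    using mor that unfolding m'_def bij_betw_def by (auto simp: f_inv_into_f inv_into_into)
  \<comment> \<open>The endpoints of \<open>m' g\<close> are known only through \<open>F\<close>;
    since \<open>o'\<close> inverts \<open>fobj F\<close> on objects, they are \<open>o' a\<close>
    and \<open>o' b\<close>.\<close>
  have m'_hom: "m' g \<in> hom A (o' a) (o' b)" if g: "g \<in> hom B a b" for g a b
  proof -
    have m: "m' g \<in> Mor A" "fmor F (m' g) = g" using Fm' g by (auto simp: hom_MorD)
    then have "g \<in> hom B (fobj F (Dom A (m' g))) (fobj F (Cod A (m' g)))"
      using fmor_hom[OF Mor_hom[OF m(1)]] by simp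
    then have "a = fobj F (Dom A (m' g))" "b = fobj F (Cod A (m' g))"
      using g by (auto simp: hom_def)
    then show ?thesis using m by (simp add: hom_def A.Dom_Obj A.Cod_Obj)
  qed
  define G where "G = \<lparr>fobj = restrict o' (Obj B), fmor = restrict m' (Mor B)\<rparr>"
  have [simp]: "fobj G = restrict o' (Obj B)" "fmor G = restrict m' (Mor B)"
    by (simp_all add: G_def)
  have G: "cat_functor B A G"
  proof (rule cat_functorI)
    fix a b f assume f: "f \<in> hom B a b"
    then show "fmor G f \<in> hom A (fobj G a) (fobj G b)"
      using m'_hom[OF f] B.hom_Obj1[OF f] B.hom_Obj2[OF f] by (simp add: hom_MorD)
  next
    fix b assume b: "b \<in> Obj B"
    then have "Ident B b = fmor F (Ident A (o' b))" by (simp add: fmor_Ident Fo')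
    then show "fmor G (Ident B b) = Ident A (fobj G b)"
      using b hom_MorD[OF B.Ident_hom[OF b]] hom_MorD[OF A.Ident_hom[OF Fo'(2)[OF b]]]
      by simp
  next
    fix a b c f g assume fg: "f \<in> hom B a b" "g \<in> hom B b c"
    have "Comp B g f = fmor F (Comp A (m' g) (m' f))"
      using fg by (simp add: fmor_Comp[OF m'_hom m'_hom] Fm' hom_MorD)
    then show "fmor G (Comp B g f) = Comp A (fmor G g) (fmor G f)"
      using fg hom_MorD[OF B.Comp_hom[OF fg]] hom_MorD[OF A.Comp_hom[OF m'_hom m'_hom, OF fg]]
      by (simp add: hom_MorD)
  qed (auto simp: A.category_axioms B.category_axioms Fo')
  have "comp_ftr A G F = id_ftr A"
    by (rule cat_functor_eqI[of A A])
      (auto intro!: comp_ftr_functor[where B = B] id_ftr_functor F G A.category_axioms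
        simp: fobj_Obj hom_MorD[OF fmor_hom[OF Mor_hom]])
  moreover have "comp_ftr B F G = id_ftr B"
    by (rule cat_functor_eqI[of B B])
      (auto intro!: comp_ftr_functor[where B = A] id_ftr_functor F G B.category_axioms
        simp: Fo' Fm')
  ultimately show ?thesis
    using F G by (auto simp: iso_of_categories_def)
qed

section \<open>Natural transformations and the functor category\<close>

lemma id_nt_nat_trans:
  assumes "cat_functor A B F"
  shows "nat_trans A B F F (id_nt A B F)"
proof -
  interpret cat_functor A B F by fact
  show ?thesis
  proof (rule nat_transI)
    fix a b f assume f: "f \<in> hom A a b"
    then show "Comp B (fmor F f) (id_nt A B F a) = Comp B (id_nt A B F b) (fmor F f)"
      using fmor_hom[OF f] A.hom_Obj1[OF f] A.hom_Obj2[OF f]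
      by (simp add: id_nt_def B.Comp_Ident B.Ident_Comp)
  qed (auto simp: cat_functor_axioms id_nt_def B.Ident_hom fobj_Obj)
qed

lemma vcomp_nat_trans:
  assumes "nat_trans A B F G \<alpha>" "nat_trans A B G H \<beta>"
  shows "nat_trans A B F H (vcomp A B \<beta> \<alpha>)"
proof -
  interpret \<alpha>: nat_trans A B F G \<alpha> by fact
  interpret \<beta>: nat_trans A B G H \<beta> by fact
  note B_assoc = \<alpha>.F.B.Comp_assoc
  show ?thesis
  proof (rule nat_transI)
    fix a b f assume f: "f \<in> hom A a b"
    note ab = \<alpha>.F.A.hom_Obj1[OF f] \<alpha>.F.A.hom_Obj2[OF f]
    have "Comp B (fmor H f) (Comp B (\<beta> a) (\<alpha> a)) = Comp B (Comp B (fmor H f) (\<beta> a)) (\<alpha> a)"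
      using B_assoc \<alpha>.component[OF ab(1)] \<beta>.component[OF ab(1)] \<beta>.G.fmor_hom[OF f] .
    also have "\<dots> = Comp B (\<beta> b) (Comp B (fmor G f) (\<alpha> a))"
      using B_assoc[OF \<alpha>.component[OF ab(1)] \<alpha>.G.fmor_hom[OF f] \<beta>.component[OF ab(2)]]
      by (simp add: \<beta>.natural[OF f])
    also have "\<dots> = Comp B (Comp B (\<beta> b) (\<alpha> b)) (fmor F f)"
      using B_assoc[OF \<alpha>.F.fmor_hom[OF f] \<alpha>.component[OF ab(2)] \<beta>.component[OF ab(2)]]
      by (simp add: \<alpha>.natural[OF f])
    finally show "Comp B (fmor H f) (vcomp A B \<beta> \<alpha> a) = Comp B (vcomp A B \<beta> \<alpha> b) (fmor F f)"
      using ab by (simp add: vcomp_def)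
  qed (auto simp: \<alpha>.F.cat_functor_axioms \<beta>.G.cat_functor_axioms vcomp_def
      intro: \<alpha>.F.B.Comp_hom \<alpha>.component \<beta>.component)
qed

lemma fun_cat_hom: "f \<in> hom (fun_cat A B) F G \<longleftrightarrow> (\<exists>\<alpha>. f = (F, \<alpha>, G) \<and> nat_trans A B F G \<alpha>)"
  by (auto simp: hom_def fun_cat_def)

text \<open>\<open>cat_functor\<close> includes that its source and target are categories, so the
  comparison functor presupposes this.\<close>

lemma category_fun_cat:
  assumes "category A" "category B"
  shows "category (fun_cat A B)"
proof
  interpret B: category B by fact
  have Comp: "Comp (fun_cat A B) (G, \<beta>, H) (F, \<alpha>, G') = (F, vcomp A B \<beta> \<alpha>, H)" for F G G' H \<alpha> \<beta>
    by (simp add: fun_cat_def)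
  have Ident: "Ident (fun_cat A B) F = (F, id_nt A B F, F)" for F
    by (simp add: fun_cat_def)
  fix f g h F G H K
  show "f \<in> Mor (fun_cat A B) \<Longrightarrow> Dom (fun_cat A B) f \<in> Obj (fun_cat A B)"
    by (auto simp: fun_cat_def nat_trans_def)
  show "f \<in> Mor (fun_cat A B) \<Longrightarrow> Cod (fun_cat A B) f \<in> Obj (fun_cat A B)"
    by (auto simp: fun_cat_def nat_trans_def)
  show "F \<in> Obj (fun_cat A B) \<Longrightarrow> Ident (fun_cat A B) F \<in> hom (fun_cat A B) F F"
    unfolding fun_cat_hom Ident by (auto simp: fun_cat_def id_nt_nat_trans)
  show "f \<in> hom (fun_cat A B) F G \<Longrightarrow> g \<in> hom (fun_cat A B) G H
      \<Longrightarrow> Comp (fun_cat A B) g f \<in> hom (fun_cat A B) F H"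
    unfolding fun_cat_hom by (auto simp: Comp vcomp_nat_trans)
  show "Comp (fun_cat A B) f (Ident (fun_cat A B) F) = f" if f: "f \<in> hom (fun_cat A B) F G"
  proof -
    obtain \<alpha> where \<alpha>: "f = (F, \<alpha>, G)" "nat_trans A B F G \<alpha>" using f unfolding fun_cat_hom by blast
    then have "vcomp A B \<alpha> (id_nt A B F) = \<alpha>"
      using nat_trans.ext[OF \<alpha>(2)]
      by (auto simp: vcomp_def id_nt_def fun_eq_iff extensional_def
          B.Comp_Ident[OF nat_trans.component[OF \<alpha>(2)]])
    then show ?thesis using \<alpha> by (simp add: Comp Ident)
  qed
  show "Comp (fun_cat A B) (Ident (fun_cat A B) G) f = f" if f: "f \<in> hom (fun_cat A B) F G"
  proof -
    obtain \<alpha> where \<alpha>: "f = (F, \<alpha>, G)" "nat_trans A B F G \<alpha>" using f unfolding fun_cat_hom by blast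
    then have "vcomp A B (id_nt A B G) \<alpha> = \<alpha>"
      using nat_trans.ext[OF \<alpha>(2)]
      by (auto simp: vcomp_def id_nt_def fun_eq_iff extensional_def
          B.Ident_Comp[OF nat_trans.component[OF \<alpha>(2)]])
    then show ?thesis using \<alpha> by (simp add: Comp Ident)
  qed
  assume "f \<in> hom (fun_cat A B) F G" "g \<in> hom (fun_cat A B) G H" "h \<in> hom (fun_cat A B) H K"
  then obtain \<alpha> \<beta> \<gamma> where eq: "f = (F, \<alpha>, G)" "g = (G, \<beta>, H)" "h = (H, \<gamma>, K)"
    and nt: "nat_trans A B F G \<alpha>" "nat_trans A B G H \<beta>" "nat_trans A B H K \<gamma>"
    unfolding fun_cat_hom by blast
  have "vcomp A B \<gamma> (vcomp A B \<beta> \<alpha>) = vcomp A B (vcomp A B \<gamma> \<beta>) \<alpha>"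
    by (auto simp: vcomp_def fun_eq_iff B.Comp_assoc[OF nt[THEN nat_trans.component]])
  then show "Comp (fun_cat A B) h (Comp (fun_cat A B) g f)
      = Comp (fun_cat A B) (Comp (fun_cat A B) h g) f"
    by (simp add: eq Comp)
qed


section \<open>Inverses\<close>

text \<open>A relation between the two arrows with explicit endpoints, so that functors carry it
  along and the inverse of a cell can be chosen object by object.\<close>

definition inverse_pair :: "('o, 'm) cat \<Rightarrow> 'o \<Rightarrow> 'o \<Rightarrow> 'm \<Rightarrow> 'm \<Rightarrow> bool" where
  "inverse_pair C a b f g \<longleftrightarrow> f \<in> hom C a b \<and> g \<in> hom C b a \<and>
    Comp C g f = Ident C a \<and> Comp C f g = Ident C b"

lemma (in category) inverse_pair_unique:
  assumes "inverse_pair C a b f g" "inverse_pair C a b f h"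
  shows "g = h"
proof -
  have "Comp C g (Comp C f h) = Comp C (Comp C g f) h"
    using assms Comp_assoc[of h b a f b g a] by (auto simp: inverse_pair_def)
  then show ?thesis using assms by (auto simp: inverse_pair_def Comp_Ident Ident_Comp)
qed

text \<open>Composing a commutative square with the inverses of its two invertible sides turns it
  around. This gives naturality of inverses, both for a pointwise inverse transformation and for the
  generators \<open>Cell_Inv\<close>.\<close>

lemma (in category) inverse_pair_conjugate:
  assumes "inverse_pair C a b f g" "inverse_pair C a' b' f' g'"
    and u: "u \<in> hom C a a'" and v: "v \<in> hom C b b'" and eq: "Comp C v f = Comp C f' u"
  shows "Comp C u g = Comp C g' v"
proof -
  have fg: "f \<in> hom C a b" "g \<in> hom C b a" "Comp C f g = Ident C b"
    "f' \<in> hom C a' b'" "g' \<in> hom C b' a'" "Comp C g' f' = Ident C a'"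
    using assms(1,2) by (auto simp: inverse_pair_def)
  have "Comp C u g = Comp C (Comp C g' f') (Comp C u g)"
    using fg u by (simp add: Ident_Comp[OF Comp_hom])
  also have "\<dots> = Comp C g' (Comp C f' (Comp C u g))"
    using Comp_assoc[OF Comp_hom[OF fg(2) u] fg(4,5)] by simp
  also have "Comp C f' (Comp C u g) = Comp C (Comp C v f) g"
    using Comp_assoc[OF fg(2) u fg(4)] eq by simp
  also have "\<dots> = v"
    using Comp_assoc[OF fg(2,1) v] fg(3) Comp_Ident[OF v] by simp
  finally show ?thesis .
qed

lemma (in cat_functor) fmor_inverse_pair:
  assumes "inverse_pair A a b f g"
  shows "inverse_pair B (fobj F a) (fobj F b) (fmor F f) (fmor F g)"
proof -
  have fg: "f \<in> hom A a b" "g \<in> hom A b a" "Comp A g f = Ident A a" "Comp A f g = Ident A b"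
    using assms by (auto simp: inverse_pair_def)
  then show ?thesis
    using fmor_hom[OF fg(1)] fmor_hom[OF fg(2)] fmor_Comp[OF fg(1,2)] fmor_Comp[OF fg(2,1)]
      fmor_Ident[OF A.hom_Obj1[OF fg(1)]] fmor_Ident[OF A.hom_Obj2[OF fg(1)]]
    by (simp add: inverse_pair_def)
qed

text \<open>Pointwise inverses assemble to a natural transformation by
  \<open>inverse_pair_conjugate\<close>. The criterion reduces the 2-cells of a cone to inverse
  pairs of arrows of the vertex.\<close>

lemma invertible_nt_iff:
  "invertible_nt A B F G \<alpha> \<longleftrightarrow> nat_trans A B F G \<alpha> \<and>
    (\<forall>a\<in>Obj A. \<exists>g. inverse_pair B (fobj F a) (fobj G a) (\<alpha> a) g)" (is "?L \<longleftrightarrow> ?R")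
proof
  assume ?L
  then obtain \<beta> where \<alpha>: "nat_trans A B F G \<alpha>" and \<beta>: "nat_trans A B G F \<beta>"
    and eq: "vcomp A B \<beta> \<alpha> = id_nt A B F" "vcomp A B \<alpha> \<beta> = id_nt A B G"
    by (auto simp: invertible_nt_def)
  have "inverse_pair B (fobj F a) (fobj G a) (\<alpha> a) (\<beta> a)" if "a \<in> Obj A" for a
    using fun_cong[OF eq(1), of a] fun_cong[OF eq(2), of a] that
      nat_trans.component[OF \<alpha> that] nat_trans.component[OF \<beta> that]
    by (simp add: inverse_pair_def vcomp_def id_nt_def)
  then show ?R using \<alpha> by blast
next
  assume R: ?R
  interpret nat_trans A B F G \<alpha> using R by blast
  obtain \<beta> where \<beta>: "\<And>a. a \<in> Obj A \<Longrightarrow> inverse_pair B (fobj F a) (fobj G a) (\<alpha> a) (\<beta> a)"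
    using R by metis
  then have eq: "a \<in> Obj A \<Longrightarrow> \<beta> a \<in> hom B (fobj G a) (fobj F a)"
    "a \<in> Obj A \<Longrightarrow> Comp B (\<beta> a) (\<alpha> a) = Ident B (fobj F a)"
    "a \<in> Obj A \<Longrightarrow> Comp B (\<alpha> a) (\<beta> a) = Ident B (fobj G a)" for a
    by (auto simp: inverse_pair_def)
  have "nat_trans A B G F (restrict \<beta> (Obj A))"
  proof (rule nat_transI)
    fix a b f assume f: "f \<in> hom A a b"
    show "Comp B (fmor F f) (restrict \<beta> (Obj A) a) = Comp B (restrict \<beta> (Obj A) b) (fmor G f)"
      using F.B.inverse_pair_conjugate[OF \<beta> \<beta> F.fmor_hom[OF f] G.fmor_hom[OF f] natural[OF f]]
        F.A.hom_Obj1[OF f] F.A.hom_Obj2[OF f] by simp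
  qed (auto simp: F.cat_functor_axioms G.cat_functor_axioms eq)
  moreover have "vcomp A B (restrict \<beta> (Obj A)) \<alpha> = id_nt A B F"
    "vcomp A B \<alpha> (restrict \<beta> (Obj A)) = id_nt A B G"
    using eq by (auto simp: vcomp_def id_nt_def fun_eq_iff)
  ultimately show ?L using R unfolding invertible_nt_def by blast
qed


section \<open>Small sets\<close>

context universe
begin

lemma Cinfinite: "Cinfinite \<kappa>"
  using card_order cinfinite_mono[OF ordLess_imp_ordLeq[OF uncountable]] natLeq_cinfinite by blast

text \<open>Closure under small unions is what regularity of \<kappa> provides.\<close>

lemma small_UN: "|I| <o \<kappa> \<Longrightarrow> (\<And>i. i \<in> I \<Longrightarrow> |A i| <o \<kappa>) \<Longrightarrow> |\<Union>i\<in>I. A i| <o \<kappa>"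
  by (rule card_of_UNION_ordLess_infinite_Field_regularCard[OF regular Cinfinite]) auto

lemma small_image: "|A| <o \<kappa> \<Longrightarrow> |f ` A| <o \<kappa>"
  using card_of_image ordLeq_ordLess_trans by blast

lemma small_subset: "|B| <o \<kappa> \<Longrightarrow> A \<subseteq> B \<Longrightarrow> |A| <o \<kappa>"
  using card_of_mono1 ordLeq_ordLess_trans by blast

lemma small_Un: "|A| <o \<kappa> \<Longrightarrow> |B| <o \<kappa> \<Longrightarrow> |A \<union> B| <o \<kappa>"
  using card_of_Un_ordLess_infinite_Field[of \<kappa> A B] Cinfinite by (simp add: cinfinite_def)

lemma small_nat: "|UNIV :: nat set| <o \<kappa>"
  using card_of_nat uncountable ordIso_ordLess_trans by blast

text \<open>The lists of one length are built by small unions, and the lengths form a countable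
  union, small because \<kappa> is uncountable. This bounds the number of paths in a graph.\<close>

lemma small_lists:
  assumes "|A| <o \<kappa>"
  shows "|lists A| <o \<kappa>"
proof -
  define L where "L n = {xs \<in> lists A. length xs = n}" for n
  have "|L n| <o \<kappa>" for n
  proof (induction n)
    case 0
    \<comment> \<open>The singleton is covered by an image of the naturals, whose smallness is
      already known.\<close>
    have "L 0 \<subseteq> (\<lambda>_. []) ` (UNIV :: nat set)" by (auto simp: L_def)
    then show ?case using small_subset small_image small_nat by blast
  next
    case (Suc n)
    have "L (Suc n) \<subseteq> (\<Union>x\<in>A. Cons x ` L n)" by (fastforce simp: L_def length_Suc_conv)
    then show ?case by (rule small_subset[rotated]) (intro small_UN small_image assms Suc)
  qed
  moreover have "lists A \<subseteq> (\<Union>n. L n)" by (auto simp: L_def)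
  ultimately show ?thesis using small_UN[OF small_nat, of L] small_subset by blast
qed

text \<open>Since \<kappa> is a cardinal order on a subset of \<open>'u\<close>, a smaller set
  injects into its field. These injections supply the labels of the relabelled category.\<close>

lemma small_embeds:
  assumes "|A| <o \<kappa>"
  obtains e :: "_ \<Rightarrow> 'u" where "inj_on e A"
proof -
  have "|A| \<le>o |Field \<kappa>|"
    by (rule ordLeq_ordIso_trans[OF ordLess_imp_ordLeq[OF assms]
          ordIso_symmetric[OF card_of_Field_ordIso[OF card_order]]])
  then show ?thesis using that card_of_ordLeq[of A "Field \<kappa>"] by blast
qed

end


section \<open>Categories presented by generators and interpretations\<close>

text \<open>
  Instead of imposing relations on the paths of a graph, two paths are identified when every
  interpretation of the graph in a prescribed class gives them the same value.
\<close>

locale interpreted_graph =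
  fixes Ob :: "'a set" and Gen :: "'g set" and src tgt :: "'g \<Rightarrow> 'a"
    and I :: "'i set" and V :: "'i \<Rightarrow> ('o, 'm) cat"
    and p :: "'i \<Rightarrow> 'a \<Rightarrow> 'o" and q :: "'i \<Rightarrow> 'g \<Rightarrow> 'm"
  assumes src_Ob: "g \<in> Gen \<Longrightarrow> src g \<in> Ob" and tgt_Ob: "g \<in> Gen \<Longrightarrow> tgt g \<in> Ob"
    and V_category: "i \<in> I \<Longrightarrow> category (V i)"
    and p_Obj: "i \<in> I \<Longrightarrow> a \<in> Ob \<Longrightarrow> p i a \<in> Obj (V i)"
    and q_hom: "i \<in> I \<Longrightarrow> g \<in> Gen \<Longrightarrow> q i g \<in> hom (V i) (p i (src g)) (p i (tgt g))"
begin

text \<open>\<open>W\<close>, \<open>ob\<close> and \<open>gen\<close> are parameters because the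
  notion is used both for \<open>path_cat\<close> and for its copies in other types.\<close>

definition realizes ::
  "('x, 'y) cat \<Rightarrow> ('a \<Rightarrow> 'x) \<Rightarrow> ('g \<Rightarrow> 'y) \<Rightarrow> 'i \<Rightarrow> ('x, 'y, 'o, 'm) ftr \<Rightarrow> bool" where
  "realizes W ob gen i H \<longleftrightarrow> cat_functor W (V i) H \<and>
    (\<forall>a\<in>Ob. fobj H (ob a) = p i a) \<and> (\<forall>g\<in>Gen. fmor H (gen g) = q i g)"

text \<open>The head of the list is the arrow traversed first. Both endpoints are arguments since
  the empty list does not determine its vertex.\<close>

fun path :: "'a \<Rightarrow> 'g list \<Rightarrow> 'a \<Rightarrow> bool" where
  "path a [] b \<longleftrightarrow> a \<in> Ob \<and> a = b"
| "path a (g # gs) b \<longleftrightarrow> g \<in> Gen \<and> src g = a \<and> path (tgt g) gs b"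

fun val :: "'i \<Rightarrow> 'a \<Rightarrow> 'g list \<Rightarrow> 'm" where
  "val i a [] = Ident (V i) (p i a)"
| "val i a (g # gs) = Comp (V i) (val i (tgt g) gs) (q i g)"

lemma path_Ob: "path a gs b \<Longrightarrow> a \<in> Ob \<and> b \<in> Ob"
  by (induction gs arbitrary: a) (auto simp: src_Ob)

lemma path_lists: "path a gs b \<Longrightarrow> gs \<in> lists Gen"
  by (induction gs arbitrary: a) auto

lemma path_append: "path a gs b \<Longrightarrow> path b hs c \<Longrightarrow> path a (gs @ hs) c"
  by (induction gs arbitrary: a) auto

lemma val_hom:
  assumes i: "i \<in> I"
  shows "path a gs b \<Longrightarrow> val i a gs \<in> hom (V i) (p i a) (p i b)"
proof (induction gs arbitrary: a)
  case Nil
  then show ?case using category.Ident_hom[OF V_category[OF i]] p_Obj[OF i] by auto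
next
  case (Cons g gs)
  then show ?case using category.Comp_hom[OF V_category[OF i] q_hom[OF i]] by auto
qed

lemma val_append:
  assumes i: "i \<in> I"
  shows "path a gs b \<Longrightarrow> path b hs c \<Longrightarrow>
    val i a (gs @ hs) = Comp (V i) (val i b hs) (val i a gs)"
proof (induction gs arbitrary: a)
  case Nil
  then show ?case using category.Comp_Ident[OF V_category[OF i] val_hom[OF i]] by auto
next
  case (Cons g gs)
  then show ?case
    using category.Comp_assoc[OF V_category[OF i] q_hom[OF i] val_hom[OF i] val_hom[OF i]]
    by auto
qed

text \<open>A class of paths is represented by its values, so neither an equivalence relation nor a
  choice of representatives occurs, and composition is componentwise. The restriction to
  \<open>I\<close> makes equality of tuples the same as equality of values; the endpoints are stored
  because different vertices may have equal values under all interpretations.\<close>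

definition path_cat :: "('a, 'a \<times> 'a \<times> ('i \<Rightarrow> 'm)) cat" where
  "path_cat =
    \<lparr>Obj = Ob,
     Mor = {(a, b, \<phi>). \<exists>gs. path a gs b \<and> \<phi> = (\<lambda>i\<in>I. val i a gs)},
     Dom = (\<lambda>(a, b, \<phi>). a),
     Cod = (\<lambda>(a, b, \<phi>). b),
     Ident = (\<lambda>a. (a, a, \<lambda>i\<in>I. Ident (V i) (p i a))),
     Comp = (\<lambda>(b, c, \<psi>) (a, _, \<phi>). (a, c, \<lambda>i\<in>I. Comp (V i) (\<psi> i) (\<phi> i)))\<rparr>"

definition path_class :: "'a \<Rightarrow> 'g list \<Rightarrow> 'a \<Rightarrow> 'a \<times> 'a \<times> ('i \<Rightarrow> 'm)" where
  "path_class a gs b = (a, b, \<lambda>i\<in>I. val i a gs)"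

lemma path_cat_hom:
  "f \<in> hom path_cat a b \<longleftrightarrow> (\<exists>gs. path a gs b \<and> f = path_class a gs b)"
  by (auto simp: hom_def path_cat_def path_class_def)

lemma path_cat_Mor: "f \<in> Mor path_cat \<longleftrightarrow> (\<exists>a gs b. path a gs b \<and> f = path_class a gs b)"
  by (auto simp: path_cat_def path_class_def)

lemma path_cat_Comp:
  assumes "path a gs b" "path b hs c"
  shows "Comp path_cat (path_class b hs c) (path_class a gs b) = path_class a (gs @ hs) c"
  using val_append[OF _ assms] by (auto simp: path_cat_def path_class_def fun_eq_iff)

lemma path_cat_Ident: "Ident path_cat a = path_class a [] a"
  by (simp add: path_cat_def path_class_def)

text \<open>The unit and associativity laws are those of list concatenation, carried over by
  \<open>path_cat_Comp\<close>.\<close>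

lemma category_path_cat: "category path_cat"
proof
  fix f g h a b c d
  show "f \<in> Mor path_cat \<Longrightarrow> Dom path_cat f \<in> Obj path_cat"
    "f \<in> Mor path_cat \<Longrightarrow> Cod path_cat f \<in> Obj path_cat"
    using path_Ob by (auto simp: path_cat_def)
  show "a \<in> Obj path_cat \<Longrightarrow> Ident path_cat a \<in> hom path_cat a a"
    unfolding path_cat_hom path_cat_Ident by (auto simp: path_cat_def intro!: exI[of _ "[]"])
  show "f \<in> hom path_cat a b \<Longrightarrow> Comp path_cat f (Ident path_cat a) = f"
    unfolding path_cat_hom path_cat_Ident
    using path_cat_Comp[of a "[]" a _ b] path_Ob by fastforce
  show "f \<in> hom path_cat a b \<Longrightarrow> Comp path_cat (Ident path_cat b) f = f"
    unfolding path_cat_hom path_cat_Ident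
    using path_cat_Comp[of a _ b "[]" b] path_Ob by fastforce
  assume f: "f \<in> hom path_cat a b" and g: "g \<in> hom path_cat b c"
  then obtain gs hs where gs: "path a gs b" "f = path_class a gs b"
    and hs: "path b hs c" "g = path_class b hs c" unfolding path_cat_hom by blast
  then show "Comp path_cat g f \<in> hom path_cat a c"
    unfolding path_cat_hom using path_cat_Comp path_append by blast
  assume "h \<in> hom path_cat c d"
  then obtain ks where "path c ks d" "h = path_class c ks d" unfolding path_cat_hom by blast
  then show "Comp path_cat h (Comp path_cat g f) = Comp path_cat (Comp path_cat h g) f"
    using gs hs path_append[of a gs b hs c] path_append[of b hs c ks d] by (simp add: path_cat_Comp)
qed

end

text \<open>The properties of \<open>path_cat\<close> that are used later, in a form invariant under
  isomorphism of categories. \<open>generated\<close> is induction on paths that puts one generator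
  in front and yields uniqueness of functors; \<open>realizable\<close> yields their existence and
  \<open>separated\<close> the equations in \<open>W\<close>.\<close>

locale presented_category =
  interpreted_graph Ob Gen src tgt I V p q + W: category W
  for Ob :: "'a set" and Gen :: "'g set" and src tgt :: "'g \<Rightarrow> 'a"
    and I :: "'i set" and V :: "'i \<Rightarrow> ('o, 'm) cat"
    and p :: "'i \<Rightarrow> 'a \<Rightarrow> 'o" and q :: "'i \<Rightarrow> 'g \<Rightarrow> 'm"
    and W :: "('x, 'y) cat" +
  fixes ob :: "'a \<Rightarrow> 'x" and gen :: "'g \<Rightarrow> 'y"
  assumes ob_bij: "bij_betw ob Ob (Obj W)"
    and gen_hom: "g \<in> Gen \<Longrightarrow> gen g \<in> hom W (ob (src g)) (ob (tgt g))"
    and generated: "f \<in> Mor W \<Longrightarrow> (\<And>a. a \<in> Ob \<Longrightarrow> P (Ident W (ob a))) \<Longrightarrow>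
      (\<And>g h c. g \<in> Gen \<Longrightarrow> h \<in> hom W (ob (tgt g)) c \<Longrightarrow> P h \<Longrightarrow> P (Comp W h (gen g))) \<Longrightarrow> P f"
    and realizable: "i \<in> I \<Longrightarrow> \<exists>H. realizes W ob gen i H"
    and separated: "f \<in> hom W x y \<Longrightarrow> f' \<in> hom W x y \<Longrightarrow>
      (\<And>i H. i \<in> I \<Longrightarrow> realizes W ob gen i H \<Longrightarrow> fmor H f = fmor H f') \<Longrightarrow> f = f'"
begin

lemma ob_Obj: "a \<in> Ob \<Longrightarrow> ob a \<in> Obj W"
  using ob_bij by (auto simp: bij_betw_def)

lemma Obj_W: "Obj W = ob ` Ob"
  using ob_bij by (auto simp: bij_betw_def)

lemma functor_eqI:
  assumes G: "cat_functor W B G" and H: "cat_functor W B H"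
    and obj: "\<And>a. a \<in> Ob \<Longrightarrow> fobj G (ob a) = fobj H (ob a)"
    and mor: "\<And>g. g \<in> Gen \<Longrightarrow> fmor G (gen g) = fmor H (gen g)"
  shows "G = H"
proof (rule cat_functor_eqI[OF G H])
  interpret G: cat_functor W B G by fact
  interpret H: cat_functor W B H by fact
  show "fobj G x = fobj H x" if "x \<in> Obj W" for x
    using that obj by (auto simp: Obj_W)
  show "fmor G f = fmor H f" if "f \<in> Mor W" for f
    using that
  proof (rule generated)
    fix a assume "a \<in> Ob"
    then show "fmor G (Ident W (ob a)) = fmor H (Ident W (ob a))"
      by (simp add: G.fmor_Ident H.fmor_Ident ob_Obj obj)
  next
    fix g h c
    assume "g \<in> Gen" "h \<in> hom W (ob (tgt g)) c" "fmor G h = fmor H h"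
    then show "fmor G (Comp W h (gen g)) = fmor H (Comp W h (gen g))"
      using G.fmor_Comp[OF gen_hom] H.fmor_Comp[OF gen_hom] mor by simp
  qed
qed

text \<open>Naturality squares paste along composition, so those at the generators suffice.\<close>

lemma nat_transI_gen:
  assumes G: "cat_functor W B G" and H: "cat_functor W B H" and ext: "\<alpha> \<in> extensional (Obj W)"
    and comp: "\<And>a. a \<in> Ob \<Longrightarrow> \<alpha> (ob a) \<in> hom B (fobj G (ob a)) (fobj H (ob a))"
    and nat: "\<And>g. g \<in> Gen \<Longrightarrow>
      Comp B (fmor H (gen g)) (\<alpha> (ob (src g))) = Comp B (\<alpha> (ob (tgt g))) (fmor G (gen g))"
  shows "nat_trans W B G H \<alpha>"
proof (rule nat_transI[OF G H ext])
  interpret G: cat_functor W B G by fact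
  interpret H: cat_functor W B H by fact
  show comp': "\<alpha> x \<in> hom B (fobj G x) (fobj H x)" if "x \<in> Obj W" for x
    using that comp by (auto simp: Obj_W)
  \<comment> \<open>The induction predicate of \<open>generated\<close> sees only the morphism, so
    the square is phrased through \<open>Dom\<close> and \<open>Cod\<close>.\<close>
  let ?P = "\<lambda>f. Comp B (fmor H f) (\<alpha> (Dom W f)) = Comp B (\<alpha> (Cod W f)) (fmor G f)"
  have "?P f" if "f \<in> Mor W" for f
    using that
  proof (rule generated)
    fix a assume a: "a \<in> Ob"
    have "Ident W (ob a) \<in> hom W (ob a) (ob a)" using W.Ident_hom ob_Obj[OF a] .
    then show "?P (Ident W (ob a))"
      using G.B.Comp_Ident[OF comp[OF a]] G.B.Ident_Comp[OF comp[OF a]]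
      by (simp add: hom_def G.fmor_Ident H.fmor_Ident ob_Obj[OF a])
  next
    fix g h c
    assume g: "g \<in> Gen" and h: "h \<in> hom W (ob (tgt g)) c" and P: "?P h"
    note gh = gen_hom[OF g]
    note st = src_Ob[OF g] tgt_Ob[OF g]
    have c: "c \<in> Obj W" using W.hom_Obj2[OF h] .
    have "Comp B (fmor H (Comp W h (gen g))) (\<alpha> (ob (src g)))
        = Comp B (fmor H h) (Comp B (fmor H (gen g)) (\<alpha> (ob (src g))))"
      using G.B.Comp_assoc[OF comp[OF st(1)] H.fmor_hom[OF gh] H.fmor_hom[OF h]]
        H.fmor_Comp[OF gh h] by simp
    also have "\<dots> = Comp B (Comp B (fmor H h) (\<alpha> (ob (tgt g)))) (fmor G (gen g))"
      using G.B.Comp_assoc[OF G.fmor_hom[OF gh] comp[OF st(2)] H.fmor_hom[OF h]] nat[OF g] by simp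
    also have "Comp B (fmor H h) (\<alpha> (ob (tgt g))) = Comp B (\<alpha> c) (fmor G h)"
      using P h by (simp add: hom_def)
    also have "Comp B (Comp B (\<alpha> c) (fmor G h)) (fmor G (gen g))
        = Comp B (\<alpha> c) (fmor G (Comp W h (gen g)))"
      using G.B.Comp_assoc[OF G.fmor_hom[OF gh] G.fmor_hom[OF h] comp'[OF c]]
        G.fmor_Comp[OF gh h] by simp
    finally show "?P (Comp W h (gen g))"
      using W.Comp_hom[OF gh h] by (simp add: hom_def)
  qed
  then show "Comp B (fmor H f) (\<alpha> x) = Comp B (\<alpha> y) (fmor G f)" if "f \<in> hom W x y" for x y f
    using that by (auto simp: hom_def)
qed

text \<open>A realization of \<open>W\<close> becomes one of \<open>W'\<close> by precomposition
  with the inverse \<open>S\<close> of \<open>R\<close>; induction and separation are pulled back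
  along \<open>S\<close>.\<close>

lemma transport:
  assumes "iso_of_categories W W' R"
  shows "presented_category Ob Gen src tgt I V p q W' (fobj R \<circ> ob) (fmor R \<circ> gen)"
proof -
  obtain S where R: "cat_functor W W' R" and S: "cat_functor W' W S"
    and SR: "comp_ftr W S R = id_ftr W" and RS: "comp_ftr W' R S = id_ftr W'"
    using assms by (auto simp: iso_of_categories_def)
  interpret R: cat_functor W W' R by fact
  interpret S: cat_functor W' W S by fact
  have SR_obj: "fobj S (fobj R a) = a" if "a \<in> Obj W" for a
    using that arg_cong[OF SR, of "\<lambda>F. fobj F a"] by simp
  have SR_mor: "fmor S (fmor R f) = f" if "f \<in> Mor W" for f
    using that arg_cong[OF SR, of "\<lambda>F. fmor F f"] by simp
  have RS_obj: "fobj R (fobj S a) = a" if "a \<in> Obj W'" for a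
    using that arg_cong[OF RS, of "\<lambda>F. fobj F a"] by simp
  have RS_mor: "fmor R (fmor S f) = f" if "f \<in> Mor W'" for f
    using that arg_cong[OF RS, of "\<lambda>F. fmor F f"] by simp
  have R_bij: "bij_betw (fobj R) (Obj W) (Obj W')"
    by (rule bij_betw_byWitness[of _ "fobj S"])
      (auto simp: SR_obj RS_obj R.fobj_Obj S.fobj_Obj)
  show ?thesis
  proof
    show "bij_betw (fobj R \<circ> ob) Ob (Obj W')"
      using bij_betw_trans[OF ob_bij R_bij] .
    show "(fmor R \<circ> gen) g \<in> hom W' ((fobj R \<circ> ob) (src g)) ((fobj R \<circ> ob) (tgt g))"
      if "g \<in> Gen" for g
      using R.fmor_hom[OF gen_hom[OF that]] by simp
  next
    fix f P
    assume f: "f \<in> Mor W'"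
      and Id: "\<And>a. a \<in> Ob \<Longrightarrow> P (Ident W' ((fobj R \<circ> ob) a))"
      and Co: "\<And>g h c. g \<in> Gen \<Longrightarrow> h \<in> hom W' ((fobj R \<circ> ob) (tgt g)) c \<Longrightarrow> P h
        \<Longrightarrow> P (Comp W' h ((fmor R \<circ> gen) g))"
    have "P (fmor R (fmor S f))"
    proof (rule generated[where P = "\<lambda>f. P (fmor R f)" and f = "fmor S f"])
      show "fmor S f \<in> Mor W" using hom_MorD[OF S.fmor_hom[OF Mor_hom[OF f]]] .
      show "P (fmor R (Ident W (ob a)))" if "a \<in> Ob" for a
        using Id[OF that] by (simp add: R.fmor_Ident ob_Obj that)
      show "P (fmor R (Comp W h (gen g)))"
        if "g \<in> Gen" "h \<in> hom W (ob (tgt g)) c" "P (fmor R h)" for g h c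
        using Co[OF that(1) _ that(3)] R.fmor_hom[OF that(2)]
          R.fmor_Comp[OF gen_hom[OF that(1)] that(2)] by auto
    qed
    then show "P f" using RS_mor[OF f] by simp
  next
    fix i assume "i \<in> I"
    then obtain H where H: "realizes W ob gen i H" using realizable by blast
    have "realizes W' (fobj R \<circ> ob) (fmor R \<circ> gen) i (comp_ftr W' H S)"
      using H comp_ftr_functor[OF S]
      by (auto simp: realizes_def R.fobj_Obj ob_Obj SR_obj SR_mor
          hom_MorD[OF gen_hom] hom_MorD[OF R.fmor_hom[OF gen_hom]])
    then show "\<exists>H. realizes W' (fobj R \<circ> ob) (fmor R \<circ> gen) i H" by blast
  next
    fix f x y f'
    assume f: "f \<in> hom W' x y" "f' \<in> hom W' x y"
      and eq: "\<And>i H. i \<in> I \<Longrightarrow> realizes W' (fobj R \<circ> ob) (fmor R \<circ> gen) i H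
        \<Longrightarrow> fmor H f = fmor H f'"
    have "fmor S f = fmor S f'"
    proof (rule separated[OF S.fmor_hom[OF f(1)] S.fmor_hom[OF f(2)]])
      fix i H assume i: "i \<in> I" and H: "realizes W ob gen i H"
      have "realizes W' (fobj R \<circ> ob) (fmor R \<circ> gen) i (comp_ftr W' H S)"
        using H comp_ftr_functor[OF S]
        by (auto simp: realizes_def R.fobj_Obj ob_Obj SR_obj SR_mor
            hom_MorD[OF gen_hom] hom_MorD[OF R.fmor_hom[OF gen_hom]])
      from eq[OF i this] show "fmor H (fmor S f) = fmor H (fmor S f')"
        using f by (simp add: hom_MorD)
    qed
    then show "f = f'" using f RS_mor by (metis hom_MorD)
  qed
qed

end

text \<open>Projection of a tuple to its coordinate at \<open>i\<close> is a functor realizing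
  \<open>i\<close>. Parallel morphisms with equal projections are equal tuples, whence
  separation.\<close>

lemma (in interpreted_graph) presented_path_cat:
  "presented_category Ob Gen src tgt I V p q path_cat id (\<lambda>g. path_class (src g) [g] (tgt g))"
proof -
  interpret category path_cat by (rule category_path_cat)
  let ?gen = "\<lambda>g. path_class (src g) [g] (tgt g)"
  have gen_path: "path (src g) [g] (tgt g)" if "g \<in> Gen" for g
    using that tgt_Ob by simp
  define H where "H i = \<lparr>fobj = restrict (p i) Ob, fmor = (\<lambda>(a, b, \<phi>)\<in>Mor path_cat. \<phi> i)\<rparr>" for i
  have fobj_H: "fobj (H i) = restrict (p i) Ob" for i by (simp add: H_def)
  have fmor_H: "fmor (H i) (path_class a gs b) = val i a gs" if "path a gs b" "i \<in> I" for i a gs b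
    using that by (auto simp: H_def path_cat_def path_class_def)
  have H: "cat_functor path_cat (V i) (H i)" if i: "i \<in> I" for i
  proof (rule cat_functorI)
    show "fobj (H i) \<in> extensional (Obj path_cat)"
      "\<And>a. a \<in> Obj path_cat \<Longrightarrow> fobj (H i) a \<in> Obj (V i)"
      by (auto simp: fobj_H path_cat_def p_Obj i)
    show "fmor (H i) \<in> extensional (Mor path_cat)" by (simp add: H_def)
    show "fmor (H i) (Ident path_cat a) = Ident (V i) (fobj (H i) a)" if "a \<in> Obj path_cat" for a
      using that i fmor_H[of a "[]" a i] by (simp add: path_cat_Ident fobj_H) (simp add: path_cat_def)
    show "fmor (H i) f \<in> hom (V i) (fobj (H i) a) (fobj (H i) b)" if "f \<in> hom path_cat a b" for a b f
      using that path_Ob val_hom[OF i] i unfolding path_cat_hom by (auto simp: fmor_H fobj_H)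
    show "fmor (H i) (Comp path_cat g f) = Comp (V i) (fmor (H i) g) (fmor (H i) f)"
      if fg: "f \<in> hom path_cat a b" "g \<in> hom path_cat b c" for a b c f g
    proof -
      obtain gs hs where "path a gs b" "f = path_class a gs b" "path b hs c" "g = path_class b hs c"
        using fg unfolding path_cat_hom by blast
      then show ?thesis
        using path_append[of a gs b hs c] val_append[of i a gs b hs c] i
        by (simp add: path_cat_Comp fmor_H)
    qed
  qed (use i V_category category_path_cat in auto)
  have realizes_H: "realizes path_cat id ?gen i (H i)" if i: "i \<in> I" for i
    unfolding realizes_def
  proof (intro conjI ballI H[OF i])
    fix g assume g: "g \<in> Gen"
    have "val i (src g) [g] = q i g"
      using category.Ident_Comp[OF V_category[OF i] q_hom[OF i g]] by simp
    then show "fmor (H i) (?gen g) = q i g"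
      using fmor_H[OF gen_path[OF g] i] by simp
  qed (simp add: fobj_H)
  show ?thesis
  proof
    show "bij_betw id Ob (Obj path_cat)" by (simp add: path_cat_def)
    show "?gen g \<in> hom path_cat (id (src g)) (id (tgt g))" if "g \<in> Gen" for g
      unfolding path_cat_hom id_apply using gen_path[OF that] by blast
    show "\<exists>H. realizes path_cat id ?gen i H" if "i \<in> I" for i
      using realizes_H[OF that] by blast
  next
    fix f P
    assume f: "f \<in> Mor path_cat"
      and Id: "\<And>a. a \<in> Ob \<Longrightarrow> P (Ident path_cat (id a))"
      and Co: "\<And>g h c. g \<in> Gen \<Longrightarrow> h \<in> hom path_cat (id (tgt g)) c \<Longrightarrow> P h
        \<Longrightarrow> P (Comp path_cat h (?gen g))"
    have "P (path_class a gs b)" if "path a gs b" for a gs b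
      using that
    proof (induction gs arbitrary: a)
      case Nil
      then show ?case using Id by (auto simp: path_cat_Ident)
    next
      case (Cons g gs)
      then have g: "g \<in> Gen" "path (src g) [g] (tgt g)" "path (tgt g) gs b" "a = src g"
        using gen_path by auto
      have "P (Comp path_cat (path_class (tgt g) gs b) (?gen g))"
        using Co[OF g(1) _ Cons.IH[OF g(3)]] g(3) path_cat_hom by fastforce
      then show ?case using path_cat_Comp[OF g(2,3)] g(4) by simp
    qed
    then show "P f" using iffD1[OF path_cat_Mor f] by blast
  next
    fix f x y f'
    assume "f \<in> hom path_cat x y" "f' \<in> hom path_cat x y"
      and eq: "\<And>i H. i \<in> I \<Longrightarrow> realizes path_cat id ?gen i H \<Longrightarrow> fmor H f = fmor H f'"
    then obtain gs gs' where gs: "path x gs y" "f = path_class x gs y"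
      and gs': "path x gs' y" "f' = path_class x gs' y" unfolding path_cat_hom by blast
    have "val i x gs = val i x gs'" if "i \<in> I" for i
      using eq[OF that realizes_H[OF that]] gs gs' that by (simp add: fmor_H)
    then show "f = f'" by (auto simp: gs gs' path_class_def)
  qed
qed

text \<open>Transport of structure: the operations decode by \<open>d\<close> and \<open>e\<close>,
  compute in \<open>C\<close> and encode again. The types of \<open>C\<close> and \<open>C'\<close>
  are independent, which lets a category of tuples move to \<open>'u\<close>.\<close>

lemma iso_relabelled:
  fixes C :: "('o, 'm) cat" and eo :: "'o \<Rightarrow> 'p" and em :: "'m \<Rightarrow> 'n"
  assumes "category C" and eo: "inj_on eo (Obj C)" and em: "inj_on em (Mor C)"
  obtains C' :: "('p, 'n) cat" and R
  where "iso_of_categories C C' R" "Obj C' = eo ` Obj C" "Mor C' = em ` Mor C"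
proof -
  interpret category C by fact
  define d where "d = inv_into (Obj C) eo"
  define e where "e = inv_into (Mor C) em"
  have d: "d (eo a) = a" if "a \<in> Obj C" for a using that eo by (simp add: d_def)
  have e: "e (em f) = f" if "f \<in> Mor C" for f using that em by (simp add: e_def)
  define C' where "C' =
    \<lparr>Obj = eo ` Obj C, Mor = em ` Mor C, Dom = (\<lambda>f. eo (Dom C (e f))), Cod = (\<lambda>f. eo (Cod C (e f))),
     Ident = (\<lambda>a. em (Ident C (d a))), Comp = (\<lambda>g f. em (Comp C (e g) (e f)))\<rparr>"
  have hom: "f \<in> hom C' a b \<longleftrightarrow> (\<exists>a' b' f'. f' \<in> hom C a' b' \<and> a = eo a' \<and> b = eo b' \<and> f = em f')"
    for f a b by (auto simp: hom_def C'_def e)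
  \<comment> \<open>Recovers composability in \<open>C\<close> from equal encoded endpoints; the
    extra arrows witness that \<open>a\<close> and \<open>b\<close> are objects, where
    \<open>eo\<close> is injective.\<close>
  have hom_eq: "a = b" if "eo a = eo b" "f \<in> hom C x a" "g \<in> hom C b y" for a b x y f g
    using that eo hom_Obj1 hom_Obj2 by (metis inj_onD)
  have Comp: "Comp C' (em g) (em f) = em (Comp C g f)" if "f \<in> Mor C" "g \<in> Mor C" for f g
    using that by (simp add: C'_def e)
  have Ident: "Ident C' (eo a) = em (Ident C a)" if "a \<in> Obj C" for a
    using that by (simp add: C'_def d)
  have Comp_ex: "\<exists>a' b' c' f' g'. f' \<in> hom C a' b' \<and> g' \<in> hom C b' c' \<and> a = eo a' \<and> b = eo b'
      \<and> c = eo c' \<and> f = em f' \<and> g = em g'"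
    if "f \<in> hom C' a b" "g \<in> hom C' b c" for f g a b c
    using that hom_eq unfolding hom by blast
  have C': "category C'"
  proof
    fix f g h a b c x
    show "f \<in> Mor C' \<Longrightarrow> Dom C' f \<in> Obj C'" "f \<in> Mor C' \<Longrightarrow> Cod C' f \<in> Obj C'"
      by (auto simp: C'_def e Dom_Obj Cod_Obj)
    show "a \<in> Obj C' \<Longrightarrow> Ident C' a \<in> hom C' a a"
      unfolding hom using Ident_hom by (fastforce simp: C'_def d)
    show "f \<in> hom C' a b \<Longrightarrow> Comp C' f (Ident C' a) = f"
      unfolding hom using hom_MorD[OF Ident_hom[OF hom_Obj1]]
      by (auto simp: Comp Ident[OF hom_Obj1] Comp_Ident hom_MorD)
    show "f \<in> hom C' a b \<Longrightarrow> Comp C' (Ident C' b) f = f"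
      unfolding hom using hom_MorD[OF Ident_hom[OF hom_Obj2]]
      by (auto simp: Comp Ident[OF hom_Obj2] Ident_Comp hom_MorD)
    assume f: "f \<in> hom C' a b" and g: "g \<in> hom C' b c"
    then obtain a' b' c' f' g' where fg: "f' \<in> hom C a' b'" "g' \<in> hom C b' c'"
      "a = eo a'" "b = eo b'" "c = eo c'" "f = em f'" "g = em g'" using Comp_ex by blast
    then show "Comp C' g f \<in> hom C' a c"
      unfolding hom using Comp_hom[OF fg(1,2)] by (auto simp: Comp hom_MorD)
    assume h: "h \<in> hom C' c x"
    obtain x' h' where h': "h' \<in> hom C c' x'" "h = em h'"
      using h fg hom_eq unfolding hom by metis
    then show "Comp C' h (Comp C' g f) = Comp C' (Comp C' h g) f"
      using fg h' Comp_hom[OF fg(1,2)] Comp_hom[OF fg(2) h'(1)] Comp_assoc[OF fg(1,2) h'(1)]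
      by (simp add: Comp hom_MorD)
  qed
  define R where "R = \<lparr>fobj = restrict eo (Obj C), fmor = restrict em (Mor C)\<rparr>"
  have "cat_functor C C' R"
  proof (rule cat_functorI)
    fix a b c f g assume fg: "f \<in> hom C a b" "g \<in> hom C b c"
    then show "fmor R (Comp C g f) = Comp C' (fmor R g) (fmor R f)"
      using Comp_hom[OF fg] by (simp add: R_def Comp hom_MorD)
  next
    fix a b f assume f: "f \<in> hom C a b"
    then show "fmor R f \<in> hom C' (fobj R a) (fobj R b)"
      using hom_Obj1[OF f] hom_Obj2[OF f] by (auto simp: R_def hom hom_MorD)
  next
    fix a assume a: "a \<in> Obj C"
    then show "fmor R (Ident C a) = Ident C' (fobj R a)"
      using hom_MorD[OF Ident_hom[OF a]] by (simp add: R_def Ident)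
  qed (auto simp: C' category_axioms R_def, auto simp: C'_def)
  moreover have "bij_betw (fobj R) (Obj C) (Obj C')" "bij_betw (fmor R) (Mor C) (Mor C')"
    using eo em by (auto simp: R_def C'_def bij_betw_def inj_on_def)
  ultimately have "iso_of_categories C C' R" by (rule iso_of_categoriesI)
  then show ?thesis using that by (simp add: C'_def)
qed

text \<open>Morphisms are counted by their paths: at most one for each pair of vertices and list of
  generators. Hence \<open>I\<close> may be arbitrarily large, and all cones can serve as
  interpretations at once.\<close>

lemma (in universe) small_presented_category:
  fixes V :: "'i \<Rightarrow> ('o, 'm) cat"
  assumes "interpreted_graph Ob Gen src tgt I V p q" and Ob: "|Ob| <o \<kappa>" and Gen: "|Gen| <o \<kappa>"
  obtains W :: "('u, 'u) cat" and ob gen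
  where "small_category \<kappa> W" "presented_category Ob Gen src tgt I V p q W ob gen"
proof -
  interpret interpreted_graph Ob Gen src tgt I V p q by fact
  interpret P: presented_category Ob Gen src tgt I V p q path_cat id
    "\<lambda>g. path_class (src g) [g] (tgt g)" by (rule presented_path_cat)
  have "Mor path_cat \<subseteq> (\<Union>a\<in>Ob. \<Union>b\<in>Ob. (\<lambda>gs. path_class a gs b) ` lists Gen)"
    using path_Ob path_lists by (fastforce simp: path_cat_Mor)
  then have mor: "|Mor path_cat| <o \<kappa>"
    by (rule small_subset[rotated]) (intro small_UN small_image small_lists Ob Gen)
  have obj: "|Obj path_cat| <o \<kappa>" using Ob by (simp add: path_cat_def)
  obtain eo :: "_ \<Rightarrow> 'u" where eo: "inj_on eo (Obj path_cat)" using small_embeds[OF obj] .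
  obtain em :: "_ \<Rightarrow> 'u" where em: "inj_on em (Mor path_cat)" using small_embeds[OF mor] .
  obtain W R where W: "iso_of_categories path_cat W R" "Obj W = eo ` Obj path_cat"
    "Mor W = em ` Mor path_cat" using iso_relabelled[OF category_path_cat eo em] .
  have "presented_category Ob Gen src tgt I V p q W (fobj R \<circ> id)
      (fmor R \<circ> (\<lambda>g. path_class (src g) [g] (tgt g)))"
    by (rule P.transport[OF W(1)])
  moreover have "small_category \<kappa> W"
    using presented_category.axioms(2)[OF calculation] W obj mor
    by (simp add: small_category_def small_image)
  ultimately show ?thesis using that by blast
qed


section \<open>Pseudo cones\<close>

text \<open>\<open>pseudo_nat\<close> demands a pseudo functor as target, so the constant one has to
  be shown coherent; all its coherence cells are the same identity.\<close>

lemma pseudo_functor_const: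
  assumes "category J" and V: "small_category \<kappa> V"
  shows "pseudo_functor \<kappa> J (const_psfun V)"
proof -
  interpret J: category J by fact
  interpret V: category V using V by (simp add: small_category_def)
  have id: "cat_functor V V (id_ftr V)" by (rule id_ftr_functor[OF V.category_axioms])
  have inv: "invertible_nt V V (id_ftr V) (id_ftr V) (id_nt V V (id_ftr V))"
    unfolding invertible_nt_iff
  proof (intro conjI ballI exI)
    fix a assume a: "a \<in> Obj V"
    show "inverse_pair V (fobj (id_ftr V) a) (fobj (id_ftr V) a) (id_nt V V (id_ftr V) a) (Ident V a)"
      using V.Ident_hom[OF a] V.Comp_Ident[OF V.Ident_hom[OF a]] a
      by (simp add: inverse_pair_def id_nt_def)
  qed (rule id_nt_nat_trans[OF id])
  have id_id: "vcomp V V (id_nt V V (id_ftr V)) (id_nt V V (id_ftr V)) = id_nt V V (id_ftr V)"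
    using V.Comp_Ident[OF V.Ident_hom] by (auto simp: vcomp_def id_nt_def fun_eq_iff)
  have whisker: "pre_whisker V (id_nt V V (id_ftr V)) (id_ftr V) = id_nt V V (id_ftr V)"
    "post_whisker V (id_ftr V) (id_nt V V (id_ftr V)) = id_nt V V (id_ftr V)"
    using hom_MorD[OF V.Ident_hom]
    by (auto simp: pre_whisker_def post_whisker_def id_nt_def fun_eq_iff)
  show ?thesis
    unfolding pseudo_functor_def pseudo_functor_axioms_def
    by (simp add: const_psfun_def assms id inv id_id whisker comp_ftr_id_left[OF id])
qed

section \<open>Componentwise form of pseudo functors, pseudo cones and modifications\<close>

context pseudo_functor
begin

lemma category_pobj: "i \<in> Obj J \<Longrightarrow> category (pobj F i)"
  using pobj by (simp add: small_category_def)

lemma fobj_pmor: "f \<in> hom J i j \<Longrightarrow> x \<in> Obj (pobj F i) \<Longrightarrow> fobj (pmor F f) x \<in> Obj (pobj F j)"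
  using cat_functor.fobj_Obj[OF pmor] .

lemma punit_hom: "i \<in> Obj J \<Longrightarrow> x \<in> Obj (pobj F i) \<Longrightarrow>
    punit F i x \<in> hom (pobj F i) x (fobj (pmor F (Ident J i)) x)"
  using nat_trans.component[of "pobj F i" "pobj F i" "id_ftr (pobj F i)" "pmor F (Ident J i)"
      "punit F i" x] punit[of i] by (simp add: invertible_nt_def)

lemma pcomp_hom: "f \<in> hom J i j \<Longrightarrow> g \<in> hom J j k \<Longrightarrow> x \<in> Obj (pobj F i) \<Longrightarrow>
    pcomp F g f x
      \<in> hom (pobj F k) (fobj (pmor F g) (fobj (pmor F f) x)) (fobj (pmor F (Comp J g f)) x)"
  using nat_trans.component[of "pobj F i" "pobj F k" "comp_ftr (pobj F i) (pmor F g) (pmor F f)"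
      "pmor F (Comp J g f)" "pcomp F g f" x] pcomp[of f i j g k] by (simp add: invertible_nt_def)

end

text \<open>For \<open>J\<close> without objects \<open>pseudo_nat\<close> says nothing about
  \<open>V\<close>, so smallness of the vertex is an assumption of its own.\<close>

locale pseudo_cone = pseudo_nat \<kappa> J F "const_psfun V" \<sigma>
  for \<kappa> :: "'u rel" and J :: "('j, 'k) cat" and F :: "('j, 'k, 'o, 'm) psfun"
    and V :: "('o, 'm) cat" and \<sigma> +
  assumes small_V: "small_category \<kappa> V"
begin

sublocale V: category V
  using small_V by (simp add: small_category_def)

lemma leg: "i \<in> Obj J \<Longrightarrow> cat_functor (pobj F i) V (tcomp \<sigma> i)"
  using tcomp[of i] by (simp add: const_psfun_def)

lemma cell: "f \<in> hom J i j \<Longrightarrow> invertible_nt (pobj F i) V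
    (tcomp \<sigma> i) (comp_ftr (pobj F i) (tcomp \<sigma> j) (pmor F f)) (tcell \<sigma> f)"
  using tcell[of f i j] comp_ftr_id_left[OF leg[of i]] F.J.hom_Obj1[of f i j]
  by (simp add: const_psfun_def)

lemma cell_extensional: "f \<in> hom J i j \<Longrightarrow> tcell \<sigma> f \<in> extensional (Obj (pobj F i))"
  using cell[of f i j] by (auto simp: invertible_nt_def nat_trans.ext)

lemma cell_inverse:
  assumes "f \<in> hom J i j" "x \<in> Obj (pobj F i)"
  shows "\<exists>g. inverse_pair V (fobj (tcomp \<sigma> i) x) (fobj (tcomp \<sigma> j) (fobj (pmor F f) x))
    (tcell \<sigma> f x) g"
  using cell[OF assms(1)] assms(2) by (simp add: invertible_nt_iff)

lemma cell_hom:
  assumes "f \<in> hom J i j" "x \<in> Obj (pobj F i)"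
  shows "tcell \<sigma> f x \<in> hom V (fobj (tcomp \<sigma> i) x) (fobj (tcomp \<sigma> j) (fobj (pmor F f) x))"
  using cell_inverse[OF assms] by (auto simp: inverse_pair_def)

lemma cell_natural:
  assumes f: "f \<in> hom J i j" and m: "m \<in> hom (pobj F i) x y"
  shows "Comp V (fmor (tcomp \<sigma> j) (fmor (pmor F f) m)) (tcell \<sigma> f x)
    = Comp V (tcell \<sigma> f y) (fmor (tcomp \<sigma> i) m)"
proof -
  have "nat_trans (pobj F i) V (tcomp \<sigma> i) (comp_ftr (pobj F i) (tcomp \<sigma> j) (pmor F f)) (tcell \<sigma> f)"
    using cell[OF f] by (simp add: invertible_nt_def)
  from nat_trans.natural[OF this m] show ?thesis using hom_MorD[OF m] by simp
qed

lemma cell_Ident: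
  assumes i: "i \<in> Obj J" and x: "x \<in> Obj (pobj F i)"
  shows "tcell \<sigma> (Ident J i) x = fmor (tcomp \<sigma> i) (punit F i x)"
  using fun_cong[OF tcell_unit[OF i], of x] x
    V.Comp_Ident[OF cell_hom[OF F.J.Ident_hom[OF i] x]] cat_functor.fobj_Obj[OF leg[OF i] x]
  by (simp add: vcomp_def pre_whisker_def post_whisker_def const_psfun_def id_nt_def)

lemma cell_Comp:
  assumes f: "f \<in> hom J i j" and g: "g \<in> hom J j k" and x: "x \<in> Obj (pobj F i)"
  shows "tcell \<sigma> (Comp J g f) x = Comp V (fmor (tcomp \<sigma> k) (pcomp F g f x))
    (Comp V (tcell \<sigma> g (fobj (pmor F f) x)) (tcell \<sigma> f x))"
  using fun_cong[OF tcell_comp[OF f g], of x] x hom_MorD[OF cell_hom[OF f x]]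
    V.Comp_Ident[OF cell_hom[OF F.J.Comp_hom[OF f g] x]]
    cat_functor.fobj_Obj[OF leg[OF F.J.hom_Obj1[OF f]] x]
  by (simp add: vcomp_def pre_whisker_def post_whisker_def const_psfun_def id_nt_def)

end

text \<open>The constant target acts on arrows by the identity functor and has identities as
  coherence cells, so the axioms shrink to equations and inverse pairs in \<open>V\<close>. In this
  form they can be verified in the colimit one at a time.\<close>

lemma (in pseudo_functor) pseudo_coneI:
  assumes V: "small_category \<kappa> V"
    and ext: "tcomp \<sigma> \<in> extensional (Obj J)" "tcell \<sigma> \<in> extensional (Mor J)"
    and leg: "\<And>i. i \<in> Obj J \<Longrightarrow> cat_functor (pobj F i) V (tcomp \<sigma> i)"
    and cell_ext: "\<And>f i j. f \<in> hom J i j \<Longrightarrow> tcell \<sigma> f \<in> extensional (Obj (pobj F i))"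
    and inv: "\<And>f i j x. f \<in> hom J i j \<Longrightarrow> x \<in> Obj (pobj F i) \<Longrightarrow>
      \<exists>g. inverse_pair V (fobj (tcomp \<sigma> i) x) (fobj (tcomp \<sigma> j) (fobj (pmor F f) x)) (tcell \<sigma> f x) g"
    and nat: "\<And>f i j m x y. f \<in> hom J i j \<Longrightarrow> m \<in> hom (pobj F i) x y \<Longrightarrow>
      Comp V (fmor (tcomp \<sigma> j) (fmor (pmor F f) m)) (tcell \<sigma> f x)
      = Comp V (tcell \<sigma> f y) (fmor (tcomp \<sigma> i) m)"
    and Ident: "\<And>i x. i \<in> Obj J \<Longrightarrow> x \<in> Obj (pobj F i) \<Longrightarrow>
      tcell \<sigma> (Ident J i) x = fmor (tcomp \<sigma> i) (punit F i x)"
    and Comp: "\<And>f g i j k x. f \<in> hom J i j \<Longrightarrow> g \<in> hom J j k \<Longrightarrow> x \<in> Obj (pobj F i) \<Longrightarrow>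
      tcell \<sigma> (Comp J g f) x = Comp V (fmor (tcomp \<sigma> k) (pcomp F g f x))
        (Comp V (tcell \<sigma> g (fobj (pmor F f) x)) (tcell \<sigma> f x))"
  shows "pseudo_cone \<kappa> J F V \<sigma>"
proof -
  interpret V: category V using V by (simp add: small_category_def)
  interpret C: pseudo_functor \<kappa> J "const_psfun V"
    by (rule pseudo_functor_const[OF J.category_axioms V])
  have hom: "tcell \<sigma> f x \<in> hom V (fobj (tcomp \<sigma> i) x) (fobj (tcomp \<sigma> j) (fobj (pmor F f) x))"
    if "f \<in> hom J i j" "x \<in> Obj (pobj F i)" for f i j x
    using inv[OF that] by (auto simp: inverse_pair_def)
  have "pseudo_nat_axioms J F (const_psfun V) \<sigma>"
  proof (rule pseudo_nat_axioms.intro)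
    fix i assume i: "i \<in> Obj J"
    show "cat_functor (pobj F i) (pobj (const_psfun V) i) (tcomp \<sigma> i)"
      using leg[OF i] by (simp add: const_psfun_def)
    show "vcomp (pobj F i) (pobj (const_psfun V) i) (tcell \<sigma> (Ident J i))
        (pre_whisker (pobj F i) (punit (const_psfun V) i) (tcomp \<sigma> i))
      = post_whisker (pobj F i) (tcomp \<sigma> i) (punit F i)"
      using V.Comp_Ident[OF hom[OF J.Ident_hom[OF i]]] cat_functor.fobj_Obj[OF leg[OF i]]
      by (auto simp: vcomp_def pre_whisker_def post_whisker_def const_psfun_def id_nt_def
          fun_eq_iff Ident i)
  next
    fix f i j assume f: "f \<in> hom J i j"
    note i = J.hom_Obj1[OF f] and j = J.hom_Obj2[OF f]
    have "nat_trans (pobj F i) V (tcomp \<sigma> i) (comp_ftr (pobj F i) (tcomp \<sigma> j) (pmor F f)) (tcell \<sigma> f)"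
      using nat[OF f]
      by (intro nat_transI leg[OF i] comp_ftr_functor[OF pmor[OF f] leg[OF j]] cell_ext[OF f])
        (auto simp: hom[OF f] hom_MorD)
    then show "invertible_nt (pobj F i) (pobj (const_psfun V) j)
        (comp_ftr (pobj F i) (pmor (const_psfun V) f) (tcomp \<sigma> i))
        (comp_ftr (pobj F i) (tcomp \<sigma> j) (pmor F f)) (tcell \<sigma> f)"
      using inv[OF f] comp_ftr_id_left[OF leg[OF i]]
      by (simp add: const_psfun_def invertible_nt_iff)
    fix g k assume g: "g \<in> hom J j k"
    show "vcomp (pobj F i) (pobj (const_psfun V) k) (tcell \<sigma> (Comp J g f))
        (pre_whisker (pobj F i) (pcomp (const_psfun V) g f) (tcomp \<sigma> i))
      = vcomp (pobj F i) (pobj (const_psfun V) k)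
        (post_whisker (pobj F i) (tcomp \<sigma> k) (pcomp F g f))
        (vcomp (pobj F i) (pobj (const_psfun V) k)
          (pre_whisker (pobj F i) (tcell \<sigma> g) (pmor F f))
          (post_whisker (pobj F i) (pmor (const_psfun V) g) (tcell \<sigma> f)))"
      using V.Comp_Ident[OF hom[OF J.Comp_hom[OF f g]]] cat_functor.fobj_Obj[OF leg[OF i]]
        hom_MorD[OF hom[OF f]]
      by (auto simp: vcomp_def pre_whisker_def post_whisker_def const_psfun_def id_nt_def
          fun_eq_iff Comp[OF f g])
  qed (use ext in auto)
  then show ?thesis
    using pseudo_functor_axioms C.pseudo_functor_axioms V
    by (simp add: pseudo_cone_def pseudo_cone_axioms_def pseudo_nat_def)
qed

lemma pseudo_cone_iff:
  "small_category \<kappa> V \<Longrightarrow> pseudo_cone \<kappa> J F V \<sigma> \<longleftrightarrow> pseudo_nat \<kappa> J F (const_psfun V) \<sigma>"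
  by (auto simp: pseudo_cone_def pseudo_cone_axioms_def)

text \<open>The modification axiom equates two functions restricted to the same carrier, hence can
  be read pointwise.\<close>

lemma cone_modification_iff:
  fixes F :: "('j, 'k, 'o, 'm) psfun"
  assumes "pseudo_cone \<kappa> J F V \<sigma>" "pseudo_cone \<kappa> J F V \<tau>"
  shows "modification \<kappa> J F (const_psfun V) \<sigma> \<tau> \<Gamma> \<longleftrightarrow> \<Gamma> \<in> extensional (Obj J) \<and>
    (\<forall>i\<in>Obj J. nat_trans (pobj F i) V (tcomp \<sigma> i) (tcomp \<tau> i) (\<Gamma> i)) \<and>
    (\<forall>f i j x. f \<in> hom J i j \<longrightarrow> x \<in> Obj (pobj F i) \<longrightarrow>
      Comp V (tcell \<tau> f x) (\<Gamma> i x) = Comp V (\<Gamma> j (fobj (pmor F f) x)) (tcell \<sigma> f x))"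
    (is "_ \<longleftrightarrow> ?ext \<and> ?comp \<and> ?nat")
proof -
  interpret S: pseudo_cone \<kappa> J F V \<sigma> by fact
  interpret T: pseudo_cone \<kappa> J F V \<tau> by fact
  let ?D = "const_psfun V :: ('j, 'k, 'o, 'm) psfun"
  let ?M = "\<lambda>f i j. vcomp (pobj F i) (pobj ?D j)
        (tcell \<tau> f) (post_whisker (pobj F i) (pmor ?D f) (\<Gamma> i))
      = vcomp (pobj F i) (pobj ?D j)
        (pre_whisker (pobj F i) (\<Gamma> j) (pmor F f)) (tcell \<sigma> f)"
  have eq: "?M f i j \<longleftrightarrow> (\<forall>x\<in>Obj (pobj F i).
      Comp V (tcell \<tau> f x) (\<Gamma> i x) = Comp V (\<Gamma> j (fobj (pmor F f) x)) (tcell \<sigma> f x))"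
    if "?comp" "f \<in> hom J i j" for f i j
  proof -
    \<comment> \<open>\<open>id_ftr V\<close> acts as the identity only on \<open>Mor V\<close>, so
      removing the whiskering requires the components to be morphisms of \<open>V\<close>.\<close>
    have "\<Gamma> i x \<in> Mor V" if "x \<in> Obj (pobj F i)" for x
      using that \<open>?comp\<close> S.F.J.hom_Obj1[OF \<open>f \<in> hom J i j\<close>] hom_MorD nat_trans.component
      by metis
    then show ?thesis
      by (auto simp: vcomp_def pre_whisker_def post_whisker_def const_psfun_def fun_eq_iff)
  qed
  have "(\<forall>f i j. f \<in> hom J i j \<longrightarrow> ?M f i j) \<longleftrightarrow> ?nat" if "?comp"
    using eq[OF that] by blast
  moreover have "pobj ?D i = V" for i by (simp add: const_psfun_def)
  ultimately show ?thesis
    unfolding modification_def modification_axioms_def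
    using S.pseudo_nat_axioms T.pseudo_nat_axioms by (auto simp only: Ball_def)
qed

lemma pseudo_cone_cat_simps:
  "Obj (pseudo_cone_cat \<kappa> J F V) = {\<sigma>. pseudo_nat \<kappa> J F (const_psfun V) \<sigma>}"
  "Ident (pseudo_cone_cat \<kappa> J F V) \<sigma> = (\<sigma>, \<lambda>i\<in>Obj J. id_nt (pobj F i) V (tcomp \<sigma> i), \<sigma>)"
  "Comp (pseudo_cone_cat \<kappa> J F V) (\<tau>', \<Delta>, \<rho>) (\<sigma>, \<Gamma>, \<tau>)
    = (\<sigma>, \<lambda>i\<in>Obj J. vcomp (pobj F i) V (\<Delta> i) (\<Gamma> i), \<rho>)"
  by (simp_all add: pseudo_cone_cat_def)

lemma pseudo_cone_cat_hom:
  "f \<in> hom (pseudo_cone_cat \<kappa> J F V) \<sigma> \<tau>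
    \<longleftrightarrow> (\<exists>\<Gamma>. f = (\<sigma>, \<Gamma>, \<tau>) \<and> modification \<kappa> J F (const_psfun V) \<sigma> \<tau> \<Gamma>)"
  by (auto simp: hom_def pseudo_cone_cat_def)

text \<open>The point beyond naturality of the components is that the modification squares of
  \<Gamma> and \<Delta> at a common arrow of \<open>J\<close> paste.\<close>

lemma category_pseudo_cone_cat:
  assumes V: "small_category \<kappa> V"
  shows "category (pseudo_cone_cat \<kappa> J F V)" (is "category ?P")
proof
  interpret V: category V using V by (simp add: small_category_def)
  have cones: "pseudo_cone \<kappa> J F V \<sigma>" "pseudo_cone \<kappa> J F V \<tau>"
    if "modification \<kappa> J F (const_psfun V) \<sigma> \<tau> \<Gamma>" for \<sigma> \<tau> \<Gamma>
    using that V by (simp_all add: pseudo_cone_iff modification_def)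
  have modD: "\<Gamma> \<in> extensional (Obj J)"
    "\<And>i. i \<in> Obj J \<Longrightarrow> nat_trans (pobj F i) V (tcomp \<sigma> i) (tcomp \<tau> i) (\<Gamma> i)"
    "\<And>f i j x. f \<in> hom J i j \<Longrightarrow> x \<in> Obj (pobj F i) \<Longrightarrow>
      Comp V (tcell \<tau> f x) (\<Gamma> i x) = Comp V (\<Gamma> j (fobj (pmor F f) x)) (tcell \<sigma> f x)"
    if "modification \<kappa> J F (const_psfun V) \<sigma> \<tau> \<Gamma>" for \<sigma> \<tau> \<Gamma>
    using that cone_modification_iff[OF cones[OF that], of \<Gamma>] by auto
  fix f g h \<sigma> \<tau> \<rho> \<upsilon>
  show "f \<in> Mor ?P \<Longrightarrow> Dom ?P f \<in> Obj ?P" "f \<in> Mor ?P \<Longrightarrow> Cod ?P f \<in> Obj ?P"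
    by (auto simp: pseudo_cone_cat_def modification_def)
  show "Ident ?P \<sigma> \<in> hom ?P \<sigma> \<sigma>" if "\<sigma> \<in> Obj ?P"
  proof -
    interpret pseudo_cone \<kappa> J F V \<sigma>
      using that V by (simp add: pseudo_cone_cat_simps pseudo_cone_iff)
    have "Comp V (tcell \<sigma> f x) (id_nt (pobj F i) V (tcomp \<sigma> i) x)
        = Comp V (id_nt (pobj F j) V (tcomp \<sigma> j) (fobj (pmor F f) x)) (tcell \<sigma> f x)"
      if "f \<in> hom J i j" "x \<in> Obj (pobj F i)" for f i j x
      using V.Comp_Ident[OF cell_hom[OF that]] V.Ident_Comp[OF cell_hom[OF that]] that(2)
        F.fobj_pmor[OF that] by (simp add: id_nt_def)
    then show ?thesis
      unfolding pseudo_cone_cat_hom pseudo_cone_cat_simps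
        cone_modification_iff[OF pseudo_cone_axioms pseudo_cone_axioms]
      using F.J.hom_Obj1 F.J.hom_Obj2 by (auto simp: id_nt_nat_trans[OF leg])
  qed
  show "Comp ?P f (Ident ?P \<sigma>) = f" if f: "f \<in> hom ?P \<sigma> \<tau>"
  proof -
    obtain \<Gamma> where \<Gamma>: "f = (\<sigma>, \<Gamma>, \<tau>)" "modification \<kappa> J F (const_psfun V) \<sigma> \<tau> \<Gamma>"
      using f unfolding pseudo_cone_cat_hom by blast
    have "vcomp (pobj F i) V (\<Gamma> i) (id_nt (pobj F i) V (tcomp \<sigma> i)) = \<Gamma> i"
      if i: "i \<in> Obj J" for i
      using nat_trans.ext[OF modD(2)[OF \<Gamma>(2) i]]
      by (auto simp: vcomp_def id_nt_def fun_eq_iff extensional_def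
          V.Comp_Ident[OF nat_trans.component[OF modD(2)[OF \<Gamma>(2) i]]])
    then show ?thesis
      using modD(1)[OF \<Gamma>(2)]
      by (auto simp: \<Gamma>(1) pseudo_cone_cat_simps fun_eq_iff extensional_def)
  qed
  show "Comp ?P (Ident ?P \<tau>) f = f" if f: "f \<in> hom ?P \<sigma> \<tau>"
  proof -
    obtain \<Gamma> where \<Gamma>: "f = (\<sigma>, \<Gamma>, \<tau>)" "modification \<kappa> J F (const_psfun V) \<sigma> \<tau> \<Gamma>"
      using f unfolding pseudo_cone_cat_hom by blast
    have "vcomp (pobj F i) V (id_nt (pobj F i) V (tcomp \<tau> i)) (\<Gamma> i) = \<Gamma> i"
      if i: "i \<in> Obj J" for i
      using nat_trans.ext[OF modD(2)[OF \<Gamma>(2) i]]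
      by (auto simp: vcomp_def id_nt_def fun_eq_iff extensional_def
          V.Ident_Comp[OF nat_trans.component[OF modD(2)[OF \<Gamma>(2) i]]])
    then show ?thesis
      using modD(1)[OF \<Gamma>(2)]
      by (auto simp: \<Gamma>(1) pseudo_cone_cat_simps fun_eq_iff extensional_def)
  qed
  assume "f \<in> hom ?P \<sigma> \<tau>" "g \<in> hom ?P \<tau> \<rho>"
  then obtain \<Gamma> \<Delta> where eq: "f = (\<sigma>, \<Gamma>, \<tau>)" "g = (\<tau>, \<Delta>, \<rho>)"
    and \<Gamma>: "modification \<kappa> J F (const_psfun V) \<sigma> \<tau> \<Gamma>"
    and \<Delta>: "modification \<kappa> J F (const_psfun V) \<tau> \<rho> \<Delta>"
    unfolding pseudo_cone_cat_hom by blast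
  interpret S: pseudo_cone \<kappa> J F V \<sigma> by (rule cones(1)[OF \<Gamma>])
  interpret T: pseudo_cone \<kappa> J F V \<tau> by (rule cones(2)[OF \<Gamma>])
  interpret R: pseudo_cone \<kappa> J F V \<rho> by (rule cones(2)[OF \<Delta>])
  have "Comp V (tcell \<rho> f x) (Comp V (\<Delta> i x) (\<Gamma> i x))
      = Comp V (Comp V (\<Delta> j (fobj (pmor F f) x)) (\<Gamma> j (fobj (pmor F f) x))) (tcell \<sigma> f x)"
    if f: "f \<in> hom J i j" and x: "x \<in> Obj (pobj F i)" for f i j x
  proof -
    note i = S.F.J.hom_Obj1[OF f] and j = S.F.J.hom_Obj2[OF f] and y = S.F.fobj_pmor[OF f x]
    note \<Gamma>_hom = nat_trans.component[OF modD(2)[OF \<Gamma>]]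
    note \<Delta>_hom = nat_trans.component[OF modD(2)[OF \<Delta>]]
    have "Comp V (tcell \<rho> f x) (Comp V (\<Delta> i x) (\<Gamma> i x))
        = Comp V (Comp V (\<Delta> j (fobj (pmor F f) x)) (tcell \<tau> f x)) (\<Gamma> i x)"
      using V.Comp_assoc[OF \<Gamma>_hom[OF i x] \<Delta>_hom[OF i x] R.cell_hom[OF f x]] modD(3)[OF \<Delta> f x]
      by simp
    also have "\<dots> = Comp V (\<Delta> j (fobj (pmor F f) x)) (Comp V (\<Gamma> j (fobj (pmor F f) x)) (tcell \<sigma> f x))"
      using V.Comp_assoc[OF \<Gamma>_hom[OF i x] T.cell_hom[OF f x] \<Delta>_hom[OF j y]] modD(3)[OF \<Gamma> f x]
      by simp
    also have "\<dots> = Comp V (Comp V (\<Delta> j (fobj (pmor F f) x)) (\<Gamma> j (fobj (pmor F f) x))) (tcell \<sigma> f x)"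
      using V.Comp_assoc[OF S.cell_hom[OF f x] \<Gamma>_hom[OF j y] \<Delta>_hom[OF j y]] .
    finally show ?thesis .
  qed
  then have "modification \<kappa> J F (const_psfun V) \<sigma> \<rho> (\<lambda>i\<in>Obj J. vcomp (pobj F i) V (\<Delta> i) (\<Gamma> i))"
    unfolding cone_modification_iff[OF S.pseudo_cone_axioms R.pseudo_cone_axioms]
    using S.F.J.hom_Obj1 S.F.J.hom_Obj2 S.F.fobj_pmor
      vcomp_nat_trans[OF modD(2)[OF \<Gamma>] modD(2)[OF \<Delta>]]
    by (auto simp: vcomp_def)
  then show "Comp ?P g f \<in> hom ?P \<sigma> \<rho>"
    unfolding pseudo_cone_cat_hom by (simp add: eq pseudo_cone_cat_simps)
  assume "h \<in> hom ?P \<rho> \<upsilon>"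
  then obtain \<Theta> where h: "h = (\<rho>, \<Theta>, \<upsilon>)" and \<Theta>: "modification \<kappa> J F (const_psfun V) \<rho> \<upsilon> \<Theta>"
    unfolding pseudo_cone_cat_hom by blast
  have "vcomp (pobj F i) V (\<Theta> i) (vcomp (pobj F i) V (\<Delta> i) (\<Gamma> i))
      = vcomp (pobj F i) V (vcomp (pobj F i) V (\<Theta> i) (\<Delta> i)) (\<Gamma> i)" if i: "i \<in> Obj J" for i
    by (auto simp: vcomp_def fun_eq_iff V.Comp_assoc[OF modD(2)[OF \<Gamma> i, THEN nat_trans.component]
          modD(2)[OF \<Delta> i, THEN nat_trans.component] modD(2)[OF \<Theta> i, THEN nat_trans.component]])
  then show "Comp ?P h (Comp ?P g f) = Comp ?P (Comp ?P h g) f"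
    by (auto simp: eq h pseudo_cone_cat_simps fun_eq_iff)
qed

section \<open>Composition of a cone with functors and natural transformations\<close>

context pseudo_cone
begin

lemma comp_cone_tcomp [simp]:
  "i \<in> Obj J \<Longrightarrow> tcomp (comp_cone J F \<sigma> G) i = comp_ftr (pobj F i) G (tcomp \<sigma> i)"
  by (simp add: comp_cone_def)

lemma comp_cone_tcell [simp]:
  "f \<in> hom J i j \<Longrightarrow> x \<in> Obj (pobj F i) \<Longrightarrow> tcell (comp_cone J F \<sigma> G) f x = fmor G (tcell \<sigma> f x)"
  by (auto simp: comp_cone_def post_whisker_def hom_def)

text \<open>The conditions on cells in \<open>pseudo_coneI\<close> are equations or inverse pairs in
  the vertex, and functors preserve both.\<close>

lemma comp_cone:
  assumes U: "small_category \<kappa> U" and G: "cat_functor V U G"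
  shows "pseudo_cone \<kappa> J F U (comp_cone J F \<sigma> G)"
proof (rule F.pseudo_coneI[OF U])
  interpret G: cat_functor V U G by fact
  show "tcomp (comp_cone J F \<sigma> G) \<in> extensional (Obj J)"
    "tcell (comp_cone J F \<sigma> G) \<in> extensional (Mor J)"
    by (simp_all add: comp_cone_def)
  show "cat_functor (pobj F i) U (tcomp (comp_cone J F \<sigma> G) i)" if "i \<in> Obj J" for i
    using comp_ftr_functor[OF leg[OF that] G] that by simp
  show "tcell (comp_cone J F \<sigma> G) f \<in> extensional (Obj (pobj F i))" if "f \<in> hom J i j" for f i j
    using that by (auto simp: comp_cone_def post_whisker_def hom_def)
  fix f i j x assume f: "f \<in> hom J i j" and x: "x \<in> Obj (pobj F i)"
  note i = F.J.hom_Obj1[OF f] and j = F.J.hom_Obj2[OF f] and y = F.fobj_pmor[OF f x]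
  obtain g where "inverse_pair V (fobj (tcomp \<sigma> i) x) (fobj (tcomp \<sigma> j) (fobj (pmor F f) x))
      (tcell \<sigma> f x) g" using cell_inverse[OF f x] by blast
  from G.fmor_inverse_pair[OF this]
  show "\<exists>g. inverse_pair U (fobj (tcomp (comp_cone J F \<sigma> G) i) x)
      (fobj (tcomp (comp_cone J F \<sigma> G) j) (fobj (pmor F f) x)) (tcell (comp_cone J F \<sigma> G) f x) g"
    using i j x y comp_cone_tcell[OF f x] by auto
  fix g k assume g: "g \<in> hom J j k"
  note gf = F.J.Comp_hom[OF f g]
  note k = F.J.hom_Obj2[OF g]
  note pc = F.pcomp_hom[OF f g x]
  show "tcell (comp_cone J F \<sigma> G) (Comp J g f) x
      = Comp U (fmor (tcomp (comp_cone J F \<sigma> G) k) (pcomp F g f x))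
        (Comp U (tcell (comp_cone J F \<sigma> G) g (fobj (pmor F f) x)) (tcell (comp_cone J F \<sigma> G) f x))"
    using comp_cone_tcell[OF gf x] comp_cone_tcell[OF f x] comp_cone_tcell[OF g y]
      cell_Comp[OF f g x] hom_MorD[OF pc] k
      G.fmor_Comp[OF cell_hom[OF f x] cell_hom[OF g y]]
      G.fmor_Comp[OF V.Comp_hom[OF cell_hom[OF f x] cell_hom[OF g y]]
        cat_functor.fmor_hom[OF leg[OF k] pc]]
    by simp
next
  fix f i j m x y assume f: "f \<in> hom J i j" and m: "m \<in> hom (pobj F i) x y"
  interpret G: cat_functor V U G by fact
  note i = F.J.hom_Obj1[OF f] and j = F.J.hom_Obj2[OF f]
  note x = category.hom_Obj1[OF F.category_pobj[OF i] m]
  note y = category.hom_Obj2[OF F.category_pobj[OF i] m]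
  note fm = cat_functor.fmor_hom[OF F.pmor[OF f] m]
  show "Comp U (fmor (tcomp (comp_cone J F \<sigma> G) j) (fmor (pmor F f) m))
      (tcell (comp_cone J F \<sigma> G) f x)
    = Comp U (tcell (comp_cone J F \<sigma> G) f y) (fmor (tcomp (comp_cone J F \<sigma> G) i) m)"
    using comp_cone_tcell[OF f x] comp_cone_tcell[OF f y] cell_natural[OF f m] i j
      hom_MorD[OF m] hom_MorD[OF fm]
      G.fmor_Comp[OF cell_hom[OF f x] cat_functor.fmor_hom[OF leg[OF j] fm]]
      G.fmor_Comp[OF cat_functor.fmor_hom[OF leg[OF i] m] cell_hom[OF f y]]
    by simp
next
  fix i x assume i: "i \<in> Obj J" and x: "x \<in> Obj (pobj F i)"
  show "tcell (comp_cone J F \<sigma> G) (Ident J i) x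
      = fmor (tcomp (comp_cone J F \<sigma> G) i) (punit F i x)"
    using comp_cone_tcell[OF F.J.Ident_hom[OF i] x] cell_Ident[OF i x] i
      hom_MorD[OF F.punit_hom[OF i x]] by simp
qed

text \<open>The modification square at \<open>f\<close> is naturality of \<alpha> at the arrow
  \<open>tcell \<sigma> f x\<close>.\<close>

lemma comp_cone_modification:
  assumes U: "small_category \<kappa> U" and \<alpha>: "nat_trans V U G H \<alpha>"
  shows "modification \<kappa> J F (const_psfun U) (comp_cone J F \<sigma> G) (comp_cone J F \<sigma> H)
    (\<lambda>i\<in>Obj J. pre_whisker (pobj F i) \<alpha> (tcomp \<sigma> i))"
proof -
  interpret \<alpha>: nat_trans V U G H \<alpha> by fact
  have "nat_trans (pobj F i) U (comp_ftr (pobj F i) G (tcomp \<sigma> i)) (comp_ftr (pobj F i) H (tcomp \<sigma> i))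
      (pre_whisker (pobj F i) \<alpha> (tcomp \<sigma> i))" if i: "i \<in> Obj J" for i
  proof -
    interpret L: cat_functor "pobj F i" V "tcomp \<sigma> i" by (rule leg[OF i])
    show ?thesis
    proof (rule nat_transI)
      fix x y m assume m: "m \<in> hom (pobj F i) x y"
      then show "Comp U (fmor (comp_ftr (pobj F i) H (tcomp \<sigma> i)) m)
          (pre_whisker (pobj F i) \<alpha> (tcomp \<sigma> i) x)
        = Comp U (pre_whisker (pobj F i) \<alpha> (tcomp \<sigma> i) y)
          (fmor (comp_ftr (pobj F i) G (tcomp \<sigma> i)) m)"
        using \<alpha>.natural[OF L.fmor_hom[OF m]] L.A.hom_Obj1[OF m] L.A.hom_Obj2[OF m]
        by (simp add: hom_MorD pre_whisker_def)
    qed (auto simp: comp_ftr_functor[OF L.cat_functor_axioms] \<alpha>.F.cat_functor_axioms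
        \<alpha>.G.cat_functor_axioms pre_whisker_def \<alpha>.component L.fobj_Obj)
  qed
  then show ?thesis
    unfolding cone_modification_iff[OF comp_cone[OF U \<alpha>.F.cat_functor_axioms]
        comp_cone[OF U \<alpha>.G.cat_functor_axioms]]
    using \<alpha>.natural[OF cell_hom] F.J.hom_Obj1 F.J.hom_Obj2 F.fobj_pmor
    by (auto simp: pre_whisker_def)
qed

text \<open>Functoriality of the comparison holds for every cone; universality enters only through
  bijectivity.\<close>

lemma comp_cone_ftr_functor:
  assumes U: "small_category \<kappa> U"
  shows "cat_functor (fun_cat V U) (pseudo_cone_cat \<kappa> J F U) (comp_cone_ftr J F V \<sigma> U)"
proof (rule cat_functorI)
  have U_cat: "category U" using U by (simp add: small_category_def)
  show "category (fun_cat V U)" by (rule category_fun_cat[OF V.category_axioms U_cat])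
  show "category (pseudo_cone_cat \<kappa> J F U)" by (rule category_pseudo_cone_cat[OF U])
  show "fobj (comp_cone_ftr J F V \<sigma> U) \<in> extensional (Obj (fun_cat V U))"
    "fmor (comp_cone_ftr J F V \<sigma> U) \<in> extensional (Mor (fun_cat V U))"
    by (simp_all add: comp_cone_ftr_def)
  have obj: "fobj (comp_cone_ftr J F V \<sigma> U) G = comp_cone J F \<sigma> G" if "cat_functor V U G" for G
    using that by (simp add: comp_cone_ftr_def fun_cat_def)
  have mor: "fmor (comp_cone_ftr J F V \<sigma> U) (G, \<alpha>, H) = (comp_cone J F \<sigma> G,
      \<lambda>i\<in>Obj J. pre_whisker (pobj F i) \<alpha> (tcomp \<sigma> i), comp_cone J F \<sigma> H)"
    if "nat_trans V U G H \<alpha>" for G \<alpha> H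
    using that by (simp add: comp_cone_ftr_def fun_cat_def)
  have functors: "cat_functor V U G" "cat_functor V U H" if "nat_trans V U G H \<alpha>" for G \<alpha> H
    using that by (simp_all add: nat_trans_def)
  show "fobj (comp_cone_ftr J F V \<sigma> U) G \<in> Obj (pseudo_cone_cat \<kappa> J F U)"
    if "G \<in> Obj (fun_cat V U)" for G
    using that comp_cone[OF U] U
    by (simp add: fun_cat_def obj pseudo_cone_cat_simps pseudo_cone_iff)
  show "fmor (comp_cone_ftr J F V \<sigma> U) f \<in> hom (pseudo_cone_cat \<kappa> J F U)
      (fobj (comp_cone_ftr J F V \<sigma> U) G) (fobj (comp_cone_ftr J F V \<sigma> U) H)"
    if "f \<in> hom (fun_cat V U) G H" for f G H
    using that comp_cone_modification[OF U] functors
    by (fastforce simp: fun_cat_hom pseudo_cone_cat_hom mor obj)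
  show "fmor (comp_cone_ftr J F V \<sigma> U) (Ident (fun_cat V U) G)
      = Ident (pseudo_cone_cat \<kappa> J F U) (fobj (comp_cone_ftr J F V \<sigma> U) G)"
    if "G \<in> Obj (fun_cat V U)" for G
  proof -
    have G: "cat_functor V U G" using that by (simp add: fun_cat_def)
    have "pre_whisker (pobj F i) (id_nt V U G) (tcomp \<sigma> i)
        = id_nt (pobj F i) U (comp_ftr (pobj F i) G (tcomp \<sigma> i))" if "i \<in> Obj J" for i
      using cat_functor.fobj_Obj[OF leg[OF that]]
      by (auto simp: pre_whisker_def id_nt_def fun_eq_iff)
    then show ?thesis
      using mor[OF id_nt_nat_trans[OF G]] obj[OF G]
      by (simp add: fun_cat_def pseudo_cone_cat_simps cong: restrict_cong)
  qed
  show "fmor (comp_cone_ftr J F V \<sigma> U) (Comp (fun_cat V U) g f)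
      = Comp (pseudo_cone_cat \<kappa> J F U) (fmor (comp_cone_ftr J F V \<sigma> U) g)
        (fmor (comp_cone_ftr J F V \<sigma> U) f)"
    if fg: "f \<in> hom (fun_cat V U) G H" "g \<in> hom (fun_cat V U) H K" for f g G H K
  proof -
    obtain \<alpha> \<beta> where eq: "f = (G, \<alpha>, H)" "g = (H, \<beta>, K)"
      and nt: "nat_trans V U G H \<alpha>" "nat_trans V U H K \<beta>"
      using fg unfolding fun_cat_hom by blast
    have Comp: "Comp (fun_cat V U) g f = (G, vcomp V U \<beta> \<alpha>, K)" by (simp add: eq fun_cat_def)
    have "pre_whisker (pobj F i) (vcomp V U \<beta> \<alpha>) (tcomp \<sigma> i)
        = vcomp (pobj F i) U (pre_whisker (pobj F i) \<beta> (tcomp \<sigma> i))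
          (pre_whisker (pobj F i) \<alpha> (tcomp \<sigma> i))" if "i \<in> Obj J" for i
      using cat_functor.fobj_Obj[OF leg[OF that]]
      by (auto simp: pre_whisker_def vcomp_def fun_eq_iff)
    then show ?thesis
      using mor[OF vcomp_nat_trans[OF nt]] mor[OF nt(1)] mor[OF nt(2)]
      unfolding Comp unfolding eq by (simp add: pseudo_cone_cat_simps cong: restrict_cong)
  qed
qed

end


section \<open>The pseudo colimit\<close>

text \<open>
  \<open>Arrow i m\<close> is the image of \<open>m\<close> under the leg at \<open>i\<close>; \<open>Cell f x\<close> and \<open>Cell_Inv f x\<close> are the
  component at \<open>x\<close> of the 2-cell of the universal cone at \<open>f\<close> and its inverse.
\<close>

datatype ('j, 'k, 'o, 'm) cone_gen = Arrow 'j 'm | Cell 'k 'o | Cell_Inv 'k 'o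

context pseudo_functor
begin

text \<open>Unions of images, here and in \<open>cone_gens\<close>, are the form to which the
  closure rules for small sets apply.\<close>

definition cone_objs :: "('j \<times> 'o) set" where
  "cone_objs = (\<Union>i\<in>Obj J. Pair i ` Obj (pobj F i))"

definition cone_gens :: "('j, 'k, 'o, 'm) cone_gen set" where
  "cone_gens = (\<Union>i\<in>Obj J. Arrow i ` Mor (pobj F i)) \<union>
    ((\<Union>f\<in>Mor J. Cell f ` Obj (pobj F (Dom J f))) \<union>
     (\<Union>f\<in>Mor J. Cell_Inv f ` Obj (pobj F (Dom J f))))"

fun gen_src :: "('j, 'k, 'o, 'm) cone_gen \<Rightarrow> 'j \<times> 'o" where
  "gen_src (Arrow i m) = (i, Dom (pobj F i) m)"
| "gen_src (Cell f x) = (Dom J f, x)"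
| "gen_src (Cell_Inv f x) = (Cod J f, fobj (pmor F f) x)"

fun gen_tgt :: "('j, 'k, 'o, 'm) cone_gen \<Rightarrow> 'j \<times> 'o" where
  "gen_tgt (Arrow i m) = (i, Cod (pobj F i) m)"
| "gen_tgt (Cell f x) = (Cod J f, fobj (pmor F f) x)"
| "gen_tgt (Cell_Inv f x) = (Dom J f, x)"

text \<open>The index set of the tuples. Its vertices are small categories in the types of the
  values of \<open>F\<close>, the same categories against which \<open>is_pseudo_colimit\<close>
  tests.\<close>

definition cones :: "(('o, 'm) cat \<times> ('j, 'k, 'o, 'm) psnat) set" where
  "cones = {(V, \<sigma>). pseudo_cone \<kappa> J F V \<sigma>}"

fun cone_obj :: "('o, 'm) cat \<times> ('j, 'k, 'o, 'm) psnat \<Rightarrow> 'j \<times> 'o \<Rightarrow> 'o" where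
  "cone_obj (V, \<sigma>) (i, x) = fobj (tcomp \<sigma> i) x"

text \<open>A cone only asserts that its cells are invertible, so the value at
  \<open>Cell_Inv\<close> has to be picked; inverses being unique, the choice is immaterial.\<close>

fun cone_mor :: "('o, 'm) cat \<times> ('j, 'k, 'o, 'm) psnat \<Rightarrow> ('j, 'k, 'o, 'm) cone_gen \<Rightarrow> 'm" where
  "cone_mor (V, \<sigma>) (Arrow i m) = fmor (tcomp \<sigma> i) m"
| "cone_mor (V, \<sigma>) (Cell f x) = tcell \<sigma> f x"
| "cone_mor (V, \<sigma>) (Cell_Inv f x) =
    (SOME g. inverse_pair V (cone_obj (V, \<sigma>) (Dom J f, x))
      (cone_obj (V, \<sigma>) (Cod J f, fobj (pmor F f) x)) (tcell \<sigma> f x) g)"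

lemma cone_objs_iff [simp]: "(i, x) \<in> cone_objs \<longleftrightarrow> i \<in> Obj J \<and> x \<in> Obj (pobj F i)"
  by (auto simp: cone_objs_def)

lemma cone_gens_iff [simp]:
  "Arrow i m \<in> cone_gens \<longleftrightarrow> i \<in> Obj J \<and> m \<in> Mor (pobj F i)"
  "Cell f x \<in> cone_gens \<longleftrightarrow> f \<in> Mor J \<and> x \<in> Obj (pobj F (Dom J f))"
  "Cell_Inv f x \<in> cone_gens \<longleftrightarrow> f \<in> Mor J \<and> x \<in> Obj (pobj F (Dom J f))"
  by (auto simp: cone_gens_def)

lemma cone_mor_inverse:
  assumes "pseudo_cone \<kappa> J F V \<sigma>" "f \<in> hom J i j" "x \<in> Obj (pobj F i)"
  shows "inverse_pair V (fobj (tcomp \<sigma> i) x) (fobj (tcomp \<sigma> j) (fobj (pmor F f) x))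
    (tcell \<sigma> f x) (cone_mor (V, \<sigma>) (Cell_Inv f x))"
  using pseudo_cone.cell_inverse[OF assms, THEN someI_ex] assms(2) by (simp add: hom_def)

lemma cone_graph: "interpreted_graph cone_objs cone_gens gen_src gen_tgt cones fst cone_obj cone_mor"
proof (rule interpreted_graph.intro)
  fix g :: "('j, 'k, 'o, 'm) cone_gen" assume g: "g \<in> cone_gens"
  show "gen_src g \<in> cone_objs" "gen_tgt g \<in> cone_objs"
    using g category.Dom_Obj[OF category_pobj] category.Cod_Obj[OF category_pobj]
      fobj_pmor[OF Mor_hom] J.Dom_Obj J.Cod_Obj by (cases g; simp)+
  fix v assume "v \<in> cones"
  then obtain V \<sigma> where v: "v = (V, \<sigma>)" and "pseudo_cone \<kappa> J F V \<sigma>" by (auto simp: cones_def)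
  then interpret pseudo_cone \<kappa> J F V \<sigma> by simp
  show "cone_mor v g \<in> hom (fst v) (cone_obj v (gen_src g)) (cone_obj v (gen_tgt g))"
  proof (cases g)
    case (Arrow i m)
    then show ?thesis using g v cat_functor.fmor_hom[OF leg Mor_hom] by simp
  next
    case (Cell f x)
    then show ?thesis using g v cell_hom[OF Mor_hom] by simp
  next
    case (Cell_Inv f x)
    then show ?thesis
      using g v cone_mor_inverse[OF pseudo_cone_axioms Mor_hom[of f J]]
      by (simp add: inverse_pair_def)
  qed
next
  fix v a assume "v \<in> cones"
  then obtain V \<sigma> where v: "v = (V, \<sigma>)" and "pseudo_cone \<kappa> J F V \<sigma>" by (auto simp: cones_def)
  then interpret pseudo_cone \<kappa> J F V \<sigma> by simp
  show "category (fst v)" using v V.category_axioms by simp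
  show "cone_obj v a \<in> Obj (fst v)" if "a \<in> cone_objs"
    using that v cat_functor.fobj_Obj[OF leg] by (cases a) simp
qed

end

text \<open>\<open>W\<close> shares the types of the values of \<open>F\<close>, since the legs of a
  cone go into a category of those types. The construction of \<open>W\<close> is hidden behind its
  presentation.\<close>

locale presented_colimit = pseudo_functor \<kappa> J F +
  P: presented_category cone_objs cone_gens gen_src gen_tgt cones fst cone_obj cone_mor W ob gen
  for \<kappa> :: "'u rel" and J :: "('j, 'k) cat" and F :: "('j, 'k, 'o, 'm) psfun"
    and W :: "('o, 'm) cat" and ob gen +
  assumes small_W: "small_category \<kappa> W"
begin

definition colim_cone :: "('j, 'k, 'o, 'm) psnat" where
  "colim_cone =
    \<lparr>tcomp = (\<lambda>i\<in>Obj J. \<lparr>fobj = (\<lambda>x\<in>Obj (pobj F i). ob (i, x)),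
       fmor = (\<lambda>m\<in>Mor (pobj F i). gen (Arrow i m))\<rparr>),
     tcell = (\<lambda>f\<in>Mor J. \<lambda>x\<in>Obj (pobj F (Dom J f)). gen (Cell f x))\<rparr>"

lemma colim_cone_simps [simp]:
  "i \<in> Obj J \<Longrightarrow> x \<in> Obj (pobj F i) \<Longrightarrow> fobj (tcomp colim_cone i) x = ob (i, x)"
  "i \<in> Obj J \<Longrightarrow> m \<in> Mor (pobj F i) \<Longrightarrow> fmor (tcomp colim_cone i) m = gen (Arrow i m)"
  "f \<in> Mor J \<Longrightarrow> x \<in> Obj (pobj F (Dom J f)) \<Longrightarrow> tcell colim_cone f x = gen (Cell f x)"
  by (simp_all add: colim_cone_def)

lemma gen_Arrow_hom: "i \<in> Obj J \<Longrightarrow> m \<in> hom (pobj F i) x y \<Longrightarrow>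
    gen (Arrow i m) \<in> hom W (ob (i, x)) (ob (i, y))"
  using P.gen_hom[of "Arrow i m"] by (auto simp: hom_def)

lemma gen_Cell_hom: "f \<in> hom J i j \<Longrightarrow> x \<in> Obj (pobj F i) \<Longrightarrow>
    gen (Cell f x) \<in> hom W (ob (i, x)) (ob (j, fobj (pmor F f) x))"
  using P.gen_hom[of "Cell f x"] by (auto simp: hom_def)

lemma gen_Cell_Inv_hom: "f \<in> hom J i j \<Longrightarrow> x \<in> Obj (pobj F i) \<Longrightarrow>
    gen (Cell_Inv f x) \<in> hom W (ob (j, fobj (pmor F f) x)) (ob (i, x))"
  using P.gen_hom[of "Cell_Inv f x"] by (auto simp: hom_def)

text \<open>\<open>P.realizes\<close> freed from the choice in \<open>cone_mor\<close>: the value at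
  \<open>Cell_Inv\<close> is only said to be an inverse of the cell.\<close>

definition factors :: "('o, 'm) cat \<Rightarrow> ('j, 'k, 'o, 'm) psnat \<Rightarrow> ('o, 'm, 'o, 'm) ftr \<Rightarrow> bool" where
  "factors V \<sigma> H \<longleftrightarrow> pseudo_cone \<kappa> J F V \<sigma> \<and> cat_functor W V H \<and>
    (\<forall>i x. i \<in> Obj J \<longrightarrow> x \<in> Obj (pobj F i) \<longrightarrow> fobj H (ob (i, x)) = fobj (tcomp \<sigma> i) x) \<and>
    (\<forall>i m. i \<in> Obj J \<longrightarrow> m \<in> Mor (pobj F i) \<longrightarrow> fmor H (gen (Arrow i m)) = fmor (tcomp \<sigma> i) m) \<and>
    (\<forall>f i j x. f \<in> hom J i j \<longrightarrow> x \<in> Obj (pobj F i) \<longrightarrow>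
      fmor H (gen (Cell f x)) = tcell \<sigma> f x \<and>
      inverse_pair V (fobj (tcomp \<sigma> i) x) (fobj (tcomp \<sigma> j) (fobj (pmor F f) x))
        (tcell \<sigma> f x) (fmor H (gen (Cell_Inv f x))))"

lemma realizes_factors:
  assumes "(V, \<sigma>) \<in> cones" "P.realizes W ob gen (V, \<sigma>) H"
  shows "factors V \<sigma> H"
proof -
  have \<sigma>: "pseudo_cone \<kappa> J F V \<sigma>" using assms(1) by (simp add: cones_def)
  have H: "cat_functor W V H" "\<And>a. a \<in> cone_objs \<Longrightarrow> fobj H (ob a) = cone_obj (V, \<sigma>) a"
    "\<And>g. g \<in> cone_gens \<Longrightarrow> fmor H (gen g) = cone_mor (V, \<sigma>) g"
    using assms(2) by (auto simp: P.realizes_def)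
  have "fmor H (gen (Cell f x)) = tcell \<sigma> f x \<and>
      inverse_pair V (fobj (tcomp \<sigma> i) x) (fobj (tcomp \<sigma> j) (fobj (pmor F f) x))
        (tcell \<sigma> f x) (fmor H (gen (Cell_Inv f x)))"
    if f: "f \<in> hom J i j" and x: "x \<in> Obj (pobj F i)" for f i j x
    \<comment> \<open>The last equation of \<open>cone_mor\<close> is kept folded, so that the
      chosen inverse matches the one in \<open>cone_mor_inverse\<close>.\<close>
    using cone_mor_inverse[OF \<sigma> f x] H(3)[of "Cell f x"] H(3)[of "Cell_Inv f x"] f x
    by (simp add: hom_def del: cone_mor.simps(3))
  then show ?thesis
    unfolding factors_def using \<sigma> H(1) H(2) H(3)[of "Arrow _ _"] by auto
qed

lemma factorization:
  assumes "pseudo_cone \<kappa> J F V \<sigma>"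
  obtains H where "factors V \<sigma> H"
proof -
  have "(V, \<sigma>) \<in> cones" using assms by (simp add: cones_def)
  then show ?thesis using P.realizable realizes_factors that by blast
qed

text \<open>The link by which laws of cones become laws in \<open>W\<close>: a factorization carries
  both sides into the vertex of a cone, where the law is known. All relations among the generators
  are obtained this way.\<close>

lemma W_eqI:
  assumes "f \<in> hom W a b" "g \<in> hom W a b"
    and "\<And>V \<sigma> H. factors V \<sigma> H \<Longrightarrow> fmor H f = fmor H g"
  shows "f = g"
  using P.separated[OF assms(1,2)] realizes_factors assms(3) by (metis surj_pair)

lemma factorsD:
  assumes "factors V \<sigma> H"
  shows "pseudo_cone \<kappa> J F V \<sigma>" "cat_functor W V H"
    and "i \<in> Obj J \<Longrightarrow> x \<in> Obj (pobj F i) \<Longrightarrow> fobj H (ob (i, x)) = fobj (tcomp \<sigma> i) x"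
    and "i \<in> Obj J \<Longrightarrow> m \<in> hom (pobj F i) x y \<Longrightarrow> fmor H (gen (Arrow i m)) = fmor (tcomp \<sigma> i) m"
    and "f \<in> hom J i j \<Longrightarrow> x \<in> Obj (pobj F i) \<Longrightarrow> fmor H (gen (Cell f x)) = tcell \<sigma> f x"
    and "f \<in> hom J i j \<Longrightarrow> x \<in> Obj (pobj F i) \<Longrightarrow>
      inverse_pair V (fobj (tcomp \<sigma> i) x) (fobj (tcomp \<sigma> j) (fobj (pmor F f) x))
        (tcell \<sigma> f x) (fmor H (gen (Cell_Inv f x)))"
  using assms by (auto simp: factors_def hom_MorD)

section \<open>Relations among the generators of \<open>W\<close>\<close>

lemma gen_Arrow_Ident:
  assumes i: "i \<in> Obj J" and x: "x \<in> Obj (pobj F i)"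
  shows "gen (Arrow i (Ident (pobj F i) x)) = Ident W (ob (i, x))"
proof (rule W_eqI)
  note id = category.Ident_hom[OF category_pobj[OF i] x]
  show "gen (Arrow i (Ident (pobj F i) x)) \<in> hom W (ob (i, x)) (ob (i, x))"
    by (rule gen_Arrow_hom[OF i id])
  show "Ident W (ob (i, x)) \<in> hom W (ob (i, x)) (ob (i, x))"
    using i x by (simp add: P.W.Ident_hom P.ob_Obj)
  fix V \<sigma> H assume fac: "factors V \<sigma> H"
  note D = factorsD[OF fac]
  show "fmor H (gen (Arrow i (Ident (pobj F i) x))) = fmor H (Ident W (ob (i, x)))"
    using D(3)[OF i x] D(4)[OF i id] cat_functor.fmor_Ident[OF D(2)]
      cat_functor.fmor_Ident[OF pseudo_cone.leg[OF D(1) i] x] i x P.ob_Obj by simp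
qed

lemma gen_Arrow_Comp:
  assumes i: "i \<in> Obj J" and m: "m \<in> hom (pobj F i) x y" and n: "n \<in> hom (pobj F i) y z"
  shows "gen (Arrow i (Comp (pobj F i) n m)) = Comp W (gen (Arrow i n)) (gen (Arrow i m))"
proof (rule W_eqI)
  note nm = category.Comp_hom[OF category_pobj[OF i] m n]
  note homs = gen_Arrow_hom[OF i m] gen_Arrow_hom[OF i n]
  show "gen (Arrow i (Comp (pobj F i) n m)) \<in> hom W (ob (i, x)) (ob (i, z))"
    by (rule gen_Arrow_hom[OF i nm])
  show "Comp W (gen (Arrow i n)) (gen (Arrow i m)) \<in> hom W (ob (i, x)) (ob (i, z))"
    by (rule P.W.Comp_hom[OF homs])
  fix V \<sigma> H assume fac: "factors V \<sigma> H"
  note D = factorsD[OF fac]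
  show "fmor H (gen (Arrow i (Comp (pobj F i) n m)))
      = fmor H (Comp W (gen (Arrow i n)) (gen (Arrow i m)))"
    using D(4)[OF i m] D(4)[OF i n] D(4)[OF i nm] cat_functor.fmor_Comp[OF D(2) homs]
      cat_functor.fmor_Comp[OF pseudo_cone.leg[OF D(1) i] m n] by simp
qed

text \<open>Both composites go to identities under every factorization, because
  \<open>Cell_Inv\<close> is sent to an inverse of the cell.\<close>

lemma gen_Cell_inverse:
  assumes f: "f \<in> hom J i j" and x: "x \<in> Obj (pobj F i)"
  shows "inverse_pair W (ob (i, x)) (ob (j, fobj (pmor F f) x))
    (gen (Cell f x)) (gen (Cell_Inv f x))"
proof -
  note i = J.hom_Obj1[OF f] and j = J.hom_Obj2[OF f] and y = fobj_pmor[OF f x]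
  note c = gen_Cell_hom[OF f x] and c' = gen_Cell_Inv_hom[OF f x]
  have ob: "ob (i, x) \<in> Obj W" "ob (j, fobj (pmor F f) x) \<in> Obj W"
    using i j x y by (simp_all add: P.ob_Obj)
  have "Comp W (gen (Cell_Inv f x)) (gen (Cell f x)) = Ident W (ob (i, x))"
  proof (rule W_eqI[OF P.W.Comp_hom[OF c c'] P.W.Ident_hom[OF ob(1)]])
    fix V \<sigma> H assume fac: "factors V \<sigma> H"
    note D = factorsD[OF fac]
    show "fmor H (Comp W (gen (Cell_Inv f x)) (gen (Cell f x))) = fmor H (Ident W (ob (i, x)))"
      using D(3)[OF i x] D(5,6)[OF f x] cat_functor.fmor_Comp[OF D(2) c c']
        cat_functor.fmor_Ident[OF D(2) ob(1)] by (simp add: inverse_pair_def)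
  qed
  moreover have "Comp W (gen (Cell f x)) (gen (Cell_Inv f x)) = Ident W (ob (j, fobj (pmor F f) x))"
  proof (rule W_eqI[OF P.W.Comp_hom[OF c' c] P.W.Ident_hom[OF ob(2)]])
    fix V \<sigma> H assume fac: "factors V \<sigma> H"
    note D = factorsD[OF fac]
    show "fmor H (Comp W (gen (Cell f x)) (gen (Cell_Inv f x)))
        = fmor H (Ident W (ob (j, fobj (pmor F f) x)))"
      using D(3)[OF j y] D(5,6)[OF f x] cat_functor.fmor_Comp[OF D(2) c' c]
        cat_functor.fmor_Ident[OF D(2) ob(2)] by (simp add: inverse_pair_def)
  qed
  ultimately show ?thesis using c c' by (simp add: inverse_pair_def)
qed

lemma gen_Cell_natural:
  assumes f: "f \<in> hom J i j" and m: "m \<in> hom (pobj F i) x y"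
  shows "Comp W (gen (Arrow j (fmor (pmor F f) m))) (gen (Cell f x))
    = Comp W (gen (Cell f y)) (gen (Arrow i m))"
proof -
  note i = J.hom_Obj1[OF f] and j = J.hom_Obj2[OF f]
  note x = category.hom_Obj1[OF category_pobj[OF i] m]
  note y = category.hom_Obj2[OF category_pobj[OF i] m]
  note fm = cat_functor.fmor_hom[OF pmor[OF f] m]
  note homs = gen_Cell_hom[OF f x] gen_Arrow_hom[OF j fm]
    gen_Arrow_hom[OF i m] gen_Cell_hom[OF f y]
  show ?thesis
  proof (rule W_eqI[OF P.W.Comp_hom[OF homs(1,2)] P.W.Comp_hom[OF homs(3,4)]])
    fix V \<sigma> H assume fac: "factors V \<sigma> H"
    note D = factorsD[OF fac]
    show "fmor H (Comp W (gen (Arrow j (fmor (pmor F f) m))) (gen (Cell f x)))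
        = fmor H (Comp W (gen (Cell f y)) (gen (Arrow i m)))"
      using D(4)[OF i m] D(4)[OF j fm] D(5)[OF f x] D(5)[OF f y]
        cat_functor.fmor_Comp[OF D(2) homs(1,2)] cat_functor.fmor_Comp[OF D(2) homs(3,4)]
        pseudo_cone.cell_natural[OF D(1) f m] by simp
  qed
qed

lemma gen_Cell_Ident:
  assumes i: "i \<in> Obj J" and x: "x \<in> Obj (pobj F i)"
  shows "gen (Cell (Ident J i) x) = gen (Arrow i (punit F i x))"
proof (rule W_eqI[OF gen_Cell_hom[OF J.Ident_hom[OF i] x] gen_Arrow_hom[OF i punit_hom[OF i x]]])
  fix V \<sigma> H assume fac: "factors V \<sigma> H"
  note D = factorsD[OF fac]
  show "fmor H (gen (Cell (Ident J i) x)) = fmor H (gen (Arrow i (punit F i x)))"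
    using D(4)[OF i punit_hom[OF i x]] D(5)[OF J.Ident_hom[OF i] x]
      pseudo_cone.cell_Ident[OF D(1) i x] by simp
qed

lemma gen_Cell_Comp:
  assumes f: "f \<in> hom J i j" and g: "g \<in> hom J j k" and x: "x \<in> Obj (pobj F i)"
  shows "gen (Cell (Comp J g f) x) = Comp W (gen (Arrow k (pcomp F g f x)))
    (Comp W (gen (Cell g (fobj (pmor F f) x))) (gen (Cell f x)))"
proof -
  note k = J.hom_Obj2[OF g] and y = fobj_pmor[OF f x]
  note gf = J.Comp_hom[OF f g] and pc = pcomp_hom[OF f g x]
  note homs = gen_Cell_hom[OF f x] gen_Cell_hom[OF g y] gen_Arrow_hom[OF k pc]
  note hom = P.W.Comp_hom[OF homs(1,2)]
  show ?thesis
  proof (rule W_eqI[OF gen_Cell_hom[OF gf x] P.W.Comp_hom[OF hom homs(3)]])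
    fix V \<sigma> H assume fac: "factors V \<sigma> H"
    note D = factorsD[OF fac]
    show "fmor H (gen (Cell (Comp J g f) x)) = fmor H (Comp W (gen (Arrow k (pcomp F g f x)))
        (Comp W (gen (Cell g (fobj (pmor F f) x))) (gen (Cell f x))))"
      using D(5)[OF f x] D(5)[OF g y] D(5)[OF gf x] D(4)[OF k pc]
        cat_functor.fmor_Comp[OF D(2) homs(1,2)] cat_functor.fmor_Comp[OF D(2) hom homs(3)]
        pseudo_cone.cell_Comp[OF D(1) f g x] by simp
  qed
qed

section \<open>The universal cone\<close>

lemma tcell_colim_cone:
  "f \<in> hom J i j \<Longrightarrow> x \<in> Obj (pobj F i) \<Longrightarrow> tcell colim_cone f x = gen (Cell f x)"
  by (auto simp: hom_def)

lemma colim_leg: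
  assumes i: "i \<in> Obj J"
  shows "cat_functor (pobj F i) W (tcomp colim_cone i)"
proof -
  interpret C: category "pobj F i" by (rule category_pobj[OF i])
  show ?thesis
  proof (rule cat_functorI)
    show "fobj (tcomp colim_cone i) \<in> extensional (Obj (pobj F i))"
      "fmor (tcomp colim_cone i) \<in> extensional (Mor (pobj F i))"
      using i by (simp_all add: colim_cone_def)
    fix x y m assume m: "m \<in> hom (pobj F i) x y"
    then show "fmor (tcomp colim_cone i) m
        \<in> hom W (fobj (tcomp colim_cone i) x) (fobj (tcomp colim_cone i) y)"
      using gen_Arrow_hom[OF i m] i C.hom_Obj1[OF m] C.hom_Obj2[OF m] by (simp add: hom_MorD)
    fix z n assume n: "n \<in> hom (pobj F i) y z"
    show "fmor (tcomp colim_cone i) (Comp (pobj F i) n m)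
        = Comp W (fmor (tcomp colim_cone i) n) (fmor (tcomp colim_cone i) m)"
      using gen_Arrow_Comp[OF i m n] i m n C.Comp_hom[OF m n] by (simp add: hom_MorD)
  qed (use i in \<open>auto simp: C.category_axioms P.W.category_axioms P.ob_Obj gen_Arrow_Ident
        hom_MorD[OF C.Ident_hom]\<close>)
qed

text \<open>The invertibility, naturality and coherence conditions of \<open>pseudo_coneI\<close>
  each match one relation among the generators.\<close>

lemma colim_pseudo_cone: "pseudo_cone \<kappa> J F W colim_cone"
proof (rule pseudo_coneI[OF small_W])
  show "tcomp colim_cone \<in> extensional (Obj J)" "tcell colim_cone \<in> extensional (Mor J)"
    by (simp_all add: colim_cone_def)
  show "tcell colim_cone f \<in> extensional (Obj (pobj F i))" if "f \<in> hom J i j" for f i j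
    using that by (auto simp: colim_cone_def hom_def)
  fix f i j x assume f: "f \<in> hom J i j" and x: "x \<in> Obj (pobj F i)"
  note i = J.hom_Obj1[OF f] and j = J.hom_Obj2[OF f] and y = fobj_pmor[OF f x]
  show "\<exists>g. inverse_pair W (fobj (tcomp colim_cone i) x)
      (fobj (tcomp colim_cone j) (fobj (pmor F f) x)) (tcell colim_cone f x) g"
    using gen_Cell_inverse[OF f x] i j x y tcell_colim_cone[OF f x] by auto
  fix g k assume g: "g \<in> hom J j k"
  show "tcell colim_cone (Comp J g f) x = Comp W (fmor (tcomp colim_cone k) (pcomp F g f x))
      (Comp W (tcell colim_cone g (fobj (pmor F f) x)) (tcell colim_cone f x))"
    using gen_Cell_Comp[OF f g x] tcell_colim_cone[OF f x] tcell_colim_cone[OF g y]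
      tcell_colim_cone[OF J.Comp_hom[OF f g] x] J.hom_Obj2[OF g] hom_MorD[OF pcomp_hom[OF f g x]]
    by simp
next
  fix f i j m x y assume f: "f \<in> hom J i j" and m: "m \<in> hom (pobj F i) x y"
  note i = J.hom_Obj1[OF f] and j = J.hom_Obj2[OF f]
  note x = category.hom_Obj1[OF category_pobj[OF i] m]
  note y = category.hom_Obj2[OF category_pobj[OF i] m]
  show "Comp W (fmor (tcomp colim_cone j) (fmor (pmor F f) m)) (tcell colim_cone f x)
      = Comp W (tcell colim_cone f y) (fmor (tcomp colim_cone i) m)"
    using gen_Cell_natural[OF f m] tcell_colim_cone[OF f x] tcell_colim_cone[OF f y] i j
      hom_MorD[OF m] hom_MorD[OF cat_functor.fmor_hom[OF pmor[OF f] m]] by simp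
next
  fix i x assume i: "i \<in> Obj J" and x: "x \<in> Obj (pobj F i)"
  show "tcell colim_cone (Ident J i) x = fmor (tcomp colim_cone i) (punit F i x)"
    using gen_Cell_Ident[OF i x] tcell_colim_cone[OF J.Ident_hom[OF i] x] i
      hom_MorD[OF punit_hom[OF i x]] by simp
qed (rule colim_leg)

sublocale colim: pseudo_cone \<kappa> J F W colim_cone
  by (rule colim_pseudo_cone)

text \<open>Existence half of the universal property on objects. The equality is strict because legs
  and cells are extensional, so agreement on the carriers suffices.\<close>

lemma comp_colim_cone_eq:
  assumes fac: "factors V \<sigma> H"
  shows "comp_cone J F colim_cone H = \<sigma>"
proof -
  note D = factorsD[OF fac]
  interpret S: pseudo_cone \<kappa> J F V \<sigma> by (rule D(1))
  interpret H: cat_functor W V H by (rule D(2))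
  interpret HC: pseudo_cone \<kappa> J F V "comp_cone J F colim_cone H"
    by (rule colim.comp_cone[OF S.small_V D(2)])
  have "tcomp (comp_cone J F colim_cone H) = tcomp \<sigma>"
  proof (rule extensionalityI[OF HC.tcomp_ext S.tcomp_ext])
    fix i assume i: "i \<in> Obj J"
    show "tcomp (comp_cone J F colim_cone H) i = tcomp \<sigma> i"
      using D(3)[OF i] D(4)[OF i Mor_hom] i
      by (intro cat_functor_eqI[OF HC.leg[OF i] S.leg[OF i]]) auto
  qed
  moreover have "tcell (comp_cone J F colim_cone H) = tcell \<sigma>"
  proof (rule extensionalityI[OF HC.tcell_ext S.tcell_ext])
    fix f assume "f \<in> Mor J"
    then have f: "f \<in> hom J (Dom J f) (Cod J f)" by (rule Mor_hom)
    show "tcell (comp_cone J F colim_cone H) f = tcell \<sigma> f"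
      using D(5)[OF f] colim.comp_cone_tcell[OF f] tcell_colim_cone[OF f]
      by (intro extensionalityI[OF HC.cell_extensional[OF f] S.cell_extensional[OF f]]) auto
  qed
  ultimately show ?thesis by simp
qed

text \<open>The composite cone fixes a functor at the generators \<open>Arrow\<close> and
  \<open>Cell\<close>; at \<open>Cell_Inv\<close> uniqueness of inverses does the rest.\<close>

lemma comp_colim_cone_inj:
  assumes V: "small_category \<kappa> V" and G: "cat_functor W V G" and H: "cat_functor W V H"
    and eq: "comp_cone J F colim_cone G = comp_cone J F colim_cone H"
  shows "G = H"
proof (rule P.functor_eqI[OF G H])
  interpret G: cat_functor W V G by fact
  interpret H: cat_functor W V H by fact
  have obj: "fobj G (ob (i, x)) = fobj H (ob (i, x))" if "i \<in> Obj J" "x \<in> Obj (pobj F i)" for i x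
    using arg_cong[OF eq, of "\<lambda>\<tau>. fobj (tcomp \<tau> i) x"] that by simp
  have cell: "fmor G (gen (Cell f x)) = fmor H (gen (Cell f x))"
    if "f \<in> hom J i j" "x \<in> Obj (pobj F i)" for f i j x
    using arg_cong[OF eq, of "\<lambda>\<tau>. tcell \<tau> f x"] colim.comp_cone_tcell[OF that]
      tcell_colim_cone[OF that] by simp
  show "fobj G (ob a) = fobj H (ob a)" if "a \<in> cone_objs" for a
    using that obj by (cases a) auto
  fix g :: "('j, 'k, 'o, 'm) cone_gen" assume g: "g \<in> cone_gens"
  show "fmor G (gen g) = fmor H (gen g)"
  proof (cases g)
    case (Arrow i m)
    then show ?thesis using arg_cong[OF eq, of "\<lambda>\<tau>. fmor (tcomp \<tau> i) m"] g by simp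
  next
    case (Cell f x)
    then show ?thesis using cell[OF Mor_hom] g by simp
  next
    case (Cell_Inv f x)
    then have f: "f \<in> hom J (Dom J f) (Cod J f)" and x: "x \<in> Obj (pobj F (Dom J f))"
      using g by (auto intro: Mor_hom)
    note inv = gen_Cell_inverse[OF f x]
    show ?thesis
      using G.B.inverse_pair_unique[OF G.fmor_inverse_pair[OF inv]] H.fmor_inverse_pair[OF inv]
        cell[OF f x] obj[OF J.hom_Obj1[OF f] x] obj[OF J.hom_Obj2[OF f] fobj_pmor[OF f x]] Cell_Inv
      by simp
  qed
qed

text \<open>Every object of \<open>W\<close> is \<open>ob (i, x)\<close> for exactly one pair, so
  the component there can only be \<open>\<Gamma> i x\<close>. Naturality at \<open>Arrow\<close> is
  naturality of \<open>\<Gamma> i\<close>, at \<open>Cell\<close> it is the modification square, and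
  at \<open>Cell_Inv\<close> the same square turned around.\<close>

lemma modification_factors:
  assumes \<sigma>: "factors V \<sigma> G" and \<tau>: "factors V \<tau> H"
    and \<Gamma>: "modification \<kappa> J F (const_psfun V) \<sigma> \<tau> \<Gamma>"
  obtains \<alpha> where "nat_trans W V G H \<alpha>"
    "(\<lambda>i\<in>Obj J. pre_whisker (pobj F i) \<alpha> (tcomp colim_cone i)) = \<Gamma>"
proof -
  note S = factorsD[OF \<sigma>] and T = factorsD[OF \<tau>]
  have ext: "\<Gamma> \<in> extensional (Obj J)"
    and nt: "\<And>i. i \<in> Obj J \<Longrightarrow> nat_trans (pobj F i) V (tcomp \<sigma> i) (tcomp \<tau> i) (\<Gamma> i)"
    and cell: "\<And>f i j x. f \<in> hom J i j \<Longrightarrow> x \<in> Obj (pobj F i) \<Longrightarrow>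
      Comp V (tcell \<tau> f x) (\<Gamma> i x) = Comp V (\<Gamma> j (fobj (pmor F f) x)) (tcell \<sigma> f x)"
    using \<Gamma> cone_modification_iff[OF S(1) T(1), of \<Gamma>] by auto
  have ob_inv: "inv_into cone_objs ob (ob (i, x)) = (i, x)"
    if "i \<in> Obj J" "x \<in> Obj (pobj F i)" for i x
    using P.ob_bij that by (simp add: bij_betw_def)
  define \<alpha> where "\<alpha> = (\<lambda>w\<in>Obj W. case inv_into cone_objs ob w of (i, x) \<Rightarrow> \<Gamma> i x)"
  have \<alpha>: "\<alpha> (ob (i, x)) = \<Gamma> i x" if "i \<in> Obj J" "x \<in> Obj (pobj F i)" for i x
    using that by (simp add: \<alpha>_def ob_inv P.ob_Obj)
  have \<Gamma>_hom: "\<Gamma> i x \<in> hom V (fobj (tcomp \<sigma> i) x) (fobj (tcomp \<tau> i) x)"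
    if "i \<in> Obj J" "x \<in> Obj (pobj F i)" for i x
    using nat_trans.component[OF nt[OF that(1)] that(2)] .
  have "nat_trans W V G H \<alpha>"
  proof (rule P.nat_transI_gen[OF S(2) T(2)])
    show "\<alpha> \<in> extensional (Obj W)" by (simp add: \<alpha>_def)
    show "\<alpha> (ob a) \<in> hom V (fobj G (ob a)) (fobj H (ob a))" if "a \<in> cone_objs" for a
      using that by (cases a) (simp add: \<alpha> S(3) T(3) \<Gamma>_hom)
    fix g :: "('j, 'k, 'o, 'm) cone_gen" assume g: "g \<in> cone_gens"
    show "Comp V (fmor H (gen g)) (\<alpha> (ob (gen_src g))) = Comp V (\<alpha> (ob (gen_tgt g))) (fmor G (gen g))"
    proof (cases g)
      case (Arrow i m)
      then have i: "i \<in> Obj J" and m: "m \<in> hom (pobj F i) (Dom (pobj F i) m) (Cod (pobj F i) m)"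
        using g by (auto intro: Mor_hom)
      note C = category_pobj[OF i]
      show ?thesis
        using nat_trans.natural[OF nt[OF i] m] S(4)[OF i m] T(4)[OF i m] i
          category.hom_Obj1[OF C m] category.hom_Obj2[OF C m] by (simp add: Arrow \<alpha>)
    next
      case (Cell f x)
      then have f: "f \<in> hom J (Dom J f) (Cod J f)" and x: "x \<in> Obj (pobj F (Dom J f))"
        using g by (auto intro: Mor_hom)
      show ?thesis
        using cell[OF f x] S(5)[OF f x] T(5)[OF f x] x J.hom_Obj1[OF f] J.hom_Obj2[OF f]
          fobj_pmor[OF f x] by (simp add: Cell \<alpha>)
    next
      case (Cell_Inv f x)
      then have f: "f \<in> hom J (Dom J f) (Cod J f)" and x: "x \<in> Obj (pobj F (Dom J f))"
        using g by (auto intro: Mor_hom)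
      note i = J.hom_Obj1[OF f] and j = J.hom_Obj2[OF f] and y = fobj_pmor[OF f x]
      have "Comp V (\<Gamma> (Dom J f) x) (fmor G (gen (Cell_Inv f x)))
          = Comp V (fmor H (gen (Cell_Inv f x))) (\<Gamma> (Cod J f) (fobj (pmor F f) x))"
        by (rule category.inverse_pair_conjugate[OF cat_functor.axioms(2)[OF S(2)] S(6)[OF f x]
              T(6)[OF f x] \<Gamma>_hom[OF i x] \<Gamma>_hom[OF j y] cell[OF f x, symmetric]])
      then show ?thesis using i j x y by (simp add: Cell_Inv \<alpha>)
    qed
  qed
  moreover have "(\<lambda>i\<in>Obj J. pre_whisker (pobj F i) \<alpha> (tcomp colim_cone i)) = \<Gamma>"
  proof (rule extensionalityI[OF _ ext])
    fix i assume i: "i \<in> Obj J"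
    have "pre_whisker (pobj F i) \<alpha> (tcomp colim_cone i) = \<Gamma> i"
      using i by (intro extensionalityI[OF _ nat_trans.ext[OF nt[OF i]]])
        (auto simp: pre_whisker_def \<alpha>)
    then show "(\<lambda>i\<in>Obj J. pre_whisker (pobj F i) \<alpha> (tcomp colim_cone i)) i = \<Gamma> i"
      using i by simp
  qed simp
  ultimately show ?thesis using that by blast
qed

text \<open>Equal whiskerings agree at each \<open>ob (i, x)\<close>, and these are all the objects
  of \<open>W\<close>.\<close>

lemma pre_whisker_colim_inj:
  assumes \<alpha>: "nat_trans W V G H \<alpha>" and \<beta>: "nat_trans W V G H \<beta>"
    and eq: "(\<lambda>i\<in>Obj J. pre_whisker (pobj F i) \<alpha> (tcomp colim_cone i))
      = (\<lambda>i\<in>Obj J. pre_whisker (pobj F i) \<beta> (tcomp colim_cone i))"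
  shows "\<alpha> = \<beta>"
proof (rule extensionalityI[OF nat_trans.ext[OF \<alpha>] nat_trans.ext[OF \<beta>]])
  fix w assume "w \<in> Obj W"
  then obtain i x where w: "w = ob (i, x)" "i \<in> Obj J" "x \<in> Obj (pobj F i)"
    by (auto simp: P.Obj_W)
  then show "\<alpha> w = \<beta> w"
    using fun_cong[OF fun_cong[OF eq, of i], of x] by (simp add: pre_whisker_def)
qed

text \<open>Bijectivity is checked separately on functors and on transformations. For the latter,
  injectivity first needs equal endpoints, because a morphism of \<open>fun_cat\<close> carries its
  source and target.\<close>

theorem colimit: "is_pseudo_colimit \<kappa> J F W colim_cone"
  unfolding is_pseudo_colimit_def
proof (intro conjI allI impI)
  fix V :: "('o, 'm) cat" assume V: "small_category \<kappa> V"
  let ?\<Phi> = "comp_cone_ftr J F W colim_cone V"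
  have obj: "fobj ?\<Phi> G = comp_cone J F colim_cone G" if "cat_functor W V G" for G
    using that by (simp add: comp_cone_ftr_def fun_cat_def)
  have mor: "fmor ?\<Phi> (G, \<alpha>, H) = (comp_cone J F colim_cone G,
      \<lambda>i\<in>Obj J. pre_whisker (pobj F i) \<alpha> (tcomp colim_cone i), comp_cone J F colim_cone H)"
    if "nat_trans W V G H \<alpha>" for G \<alpha> H
    using that by (simp add: comp_cone_ftr_def fun_cat_def)
  have functors: "cat_functor W V G" "cat_functor W V H" if "nat_trans W V G H \<alpha>" for G \<alpha> H
    using that by (simp_all add: nat_trans_def)
  show "iso_of_categories (fun_cat W V) (pseudo_cone_cat \<kappa> J F V) ?\<Phi>"
  proof (rule iso_of_categoriesI)
    show \<Phi>: "cat_functor (fun_cat W V) (pseudo_cone_cat \<kappa> J F V) ?\<Phi>"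
      by (rule colim.comp_cone_ftr_functor[OF V])
    interpret \<Phi>: cat_functor "fun_cat W V" "pseudo_cone_cat \<kappa> J F V" ?\<Phi> by (rule \<Phi>)
    show "bij_betw (fobj ?\<Phi>) (Obj (fun_cat W V)) (Obj (pseudo_cone_cat \<kappa> J F V))"
      unfolding bij_betw_def
    proof (intro conjI equalityI image_subsetI subsetI)
      show "inj_on (fobj ?\<Phi>) (Obj (fun_cat W V))"
        using comp_colim_cone_inj[OF V] by (auto simp: inj_on_def fun_cat_def obj)
      show "fobj ?\<Phi> G \<in> Obj (pseudo_cone_cat \<kappa> J F V)" if "G \<in> Obj (fun_cat W V)" for G
        using \<Phi>.fobj_Obj[OF that] .
      fix \<sigma> assume "\<sigma> \<in> Obj (pseudo_cone_cat \<kappa> J F V)"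
      then have "pseudo_cone \<kappa> J F V \<sigma>"
        using V by (simp add: pseudo_cone_cat_simps pseudo_cone_iff)
      then obtain H where H: "factors V \<sigma> H" using factorization by blast
      then have "\<sigma> = fobj ?\<Phi> H" using factorsD(2)[OF H] comp_colim_cone_eq[OF H] by (simp add: obj)
      then show "\<sigma> \<in> fobj ?\<Phi> ` Obj (fun_cat W V)"
        using factorsD(2)[OF H] by (auto simp: fun_cat_def)
    qed
    show "bij_betw (fmor ?\<Phi>) (Mor (fun_cat W V)) (Mor (pseudo_cone_cat \<kappa> J F V))"
      unfolding bij_betw_def
    proof (intro conjI equalityI image_subsetI subsetI inj_onI)
      fix a b assume "a \<in> Mor (fun_cat W V)" "b \<in> Mor (fun_cat W V)" and eq: "fmor ?\<Phi> a = fmor ?\<Phi> b"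
      then obtain G \<alpha> H G' \<beta> H' where ab: "a = (G, \<alpha>, H)" "b = (G', \<beta>, H')"
        and nt: "nat_trans W V G H \<alpha>" "nat_trans W V G' H' \<beta>" by (auto simp: fun_cat_def)
      have eqs: "comp_cone J F colim_cone G = comp_cone J F colim_cone G'"
        "comp_cone J F colim_cone H = comp_cone J F colim_cone H'"
        "(\<lambda>i\<in>Obj J. pre_whisker (pobj F i) \<alpha> (tcomp colim_cone i))
          = (\<lambda>i\<in>Obj J. pre_whisker (pobj F i) \<beta> (tcomp colim_cone i))"
        using eq by (simp_all add: ab mor[OF nt(1)] mor[OF nt(2)])
      have GH: "G = G'" "H = H'"
        using comp_colim_cone_inj[OF V] functors[OF nt(1)] functors[OF nt(2)] eqs(1,2) by blast+
      have "\<alpha> = \<beta>"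
        using pre_whisker_colim_inj[OF nt(1) _ eqs(3)] nt(2) GH by simp
      then show "a = b" by (simp add: ab GH)
    next
      show "fmor ?\<Phi> a \<in> Mor (pseudo_cone_cat \<kappa> J F V)" if "a \<in> Mor (fun_cat W V)" for a
        using hom_MorD[OF \<Phi>.fmor_hom[OF Mor_hom[OF that]]] .
    next
      fix c assume "c \<in> Mor (pseudo_cone_cat \<kappa> J F V)"
      then obtain \<sigma> \<Gamma> \<tau> where c: "c = (\<sigma>, \<Gamma>, \<tau>)"
        and \<Gamma>: "modification \<kappa> J F (const_psfun V) \<sigma> \<tau> \<Gamma>" by (auto simp: pseudo_cone_cat_def)
      have "pseudo_cone \<kappa> J F V \<sigma>" "pseudo_cone \<kappa> J F V \<tau>"
        using \<Gamma> V by (simp_all add: pseudo_cone_iff modification_def)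
      \<comment> \<open>The endpoints of the modification are factored on their own; \<Gamma> is
        then factored between these two functors.\<close>
      then obtain G H where G: "factors V \<sigma> G" and H: "factors V \<tau> H" using factorization by metis
      obtain \<alpha> where "nat_trans W V G H \<alpha>"
        "(\<lambda>i\<in>Obj J. pre_whisker (pobj F i) \<alpha> (tcomp colim_cone i)) = \<Gamma>"
        using modification_factors[OF G H \<Gamma>] .
      then have "c = fmor ?\<Phi> (G, \<alpha>, H)" "(G, \<alpha>, H) \<in> Mor (fun_cat W V)"
        using comp_colim_cone_eq[OF G] comp_colim_cone_eq[OF H] by (simp_all add: c mor fun_cat_def)
      then show "c \<in> fmor ?\<Phi> ` Mor (fun_cat W V)" by blast
    qed
  qed
qed (use small_W colim.pseudo_nat_axioms in auto)

end

theorem theorem4p2: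
  fixes \<kappa> :: "'u rel"
    and J :: "('j, 'k) cat"
    and F :: "('j, 'k, 'u, 'u) psfun"
  assumes "universe \<kappa>"
    and "small_category \<kappa> J"
    and "pseudo_functor \<kappa> J F"
  shows "\<exists>W \<pi>. is_pseudo_colimit \<kappa> J F W \<pi>"
proof -
  interpret universe \<kappa> by fact
  interpret pseudo_functor \<kappa> J F by fact
  have J: "|Obj J| <o \<kappa>" "|Mor J| <o \<kappa>" using assms(2) by (simp_all add: small_category_def)
  have F: "|Obj (pobj F i)| <o \<kappa>" "|Mor (pobj F i)| <o \<kappa>" if "i \<in> Obj J" for i
    using pobj[OF that] by (simp_all add: small_category_def)
  have "|cone_objs| <o \<kappa>"
    unfolding cone_objs_def by (intro small_UN small_image J F)
  moreover have "|cone_gens| <o \<kappa>"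
    unfolding cone_gens_def by (intro small_Un small_UN small_image J F J.Dom_Obj)
  \<comment> \<open>\<open>W\<close> comes out in \<open>'u\<close>, the type of the values of
    \<open>F\<close>, so it can serve as a vertex in \<open>presented_colimit\<close>.\<close>
  ultimately obtain W :: "('u, 'u) cat" and ob gen where "small_category \<kappa> W"
    "presented_category cone_objs cone_gens gen_src gen_tgt cones fst cone_obj cone_mor W ob gen"
    using small_presented_category[OF cone_graph] by blast
  then have "presented_colimit \<kappa> J F W ob gen"
    using assms(3) by (simp add: presented_colimit_def presented_colimit_axioms_def)
  then show ?thesis using presented_colimit.colimit by blast
qed

end
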